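(* Let $a,b$ and $x_1,\dots,x_n$ be complex parameters such that no denominator in the identity below vanishes. Let $K(\boldsymbol y)=K(y_1,\dots,y_n)$ be a complex-valued function of $n$ complex variables (defined at all points where it is evaluated below) and let $\beta(\boldsymbol j)$ be a complex-valued function of multi-indices $\boldsymbol j$. Assume that either (i) $K$ and $\beta$ are such that the series on both sides of the identity are analytic in $y_1,\dots,y_n$ and converge absolutely for each $y_r$ in a disk around the origin, and each $y_r$ lies in this disk; or (ii) $y_r=q^{N_r}$ with $N_r$ a nonnegative integer, for $r=1,\dots,n$ (so that the series on both sides terminate). Then $$\begin{aligned} &K(\boldsymbol{y})\sum_{j_1,\dots,j_n\ge 0}\ \prod_{1\leq r<s\leq n}\frac{1-q^{j_{r}-j_{s}}x_{r}/x_{s}}{1-x_{r}/x_{s}}\prod_{r,s=1}^{n}\Big(\frac{x_{r}}{x_{s}y_{s}}\Big)_{j_{r}}\\ &\qquad\times\frac{1-bq^{2|\boldsymbol{j}|}}{(1-b)(bqy_{1}\cdots y_{n})_{|\boldsymbol{j}|}}(y_{1}\cdots y_{n})^{|\boldsymbol{j}|}q^{\sum_{r=1}^{n}(r-1)j_{r}}\beta(\boldsymbol{j})\\ &=\sum_{k_1,\dots,k_n\ge 0}\ \prod_{1\leq r<s\leq n}\frac{1-q^{k_{r}-k_{s}}x_{r}/x_{s}}{1-x_{r}/x_{s}}\prod_{r,s=1}^{n}\frac{(x_{r}/(x_{s}y_{s}))_{k_{r}}}{(qx_{r}/x_{s})_{k_{r}}}\\ &\quad\times\frac{(1-aq^{2|\boldsymbol{k}|})(a)_{|\boldsymbol{k}|}}{(1-a)(aqy_{1}\cdots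 y_{n})_{|\boldsymbol{k}|}}(y_{1}\cdots y_{n})^{|\boldsymbol{k}|}q^{\sum_{r=1}^{n}(r-1)k_{r}}\\ &\quad\times\sum_{\substack{0\leq j_{r}\leq k_{r}\\ r=1,\dots,n}}\ \prod_{1\leq r<s\leq n}\frac{1-q^{j_{r}-j_{s}}x_{r}/x_{s}}{1-x_{r}/x_{s}}\prod_{r,s=1}^{n}(q^{-k_{s}}x_{r}/x_{s})_{j_{r}}\\ &\qquad\times\frac{(aq^{|\boldsymbol{k}|},bq)_{|\boldsymbol{j}|}}{(b)_{2|\boldsymbol{j}|}}(-1)^{|\boldsymbol{j}|}q^{\sum_{r=1}^{n}rj_{r}+\binom{|\boldsymbol{j}|}{2}}\beta(\boldsymbol{j})\\ &\qquad\times\sum_{\substack{0\leq m_{r}\leq k_{r}-j_{r}\\ r=1,\dots,n}}\ \prod_{1\leq r<s\leq n}\frac{1-q^{m_{r}-m_{s}+j_{r}-j_{s}}x_{r}/x_{s}}{1-q^{j_{r}-j_{s}}x_{r}/x_{s}}\,q^{\sum_{r=1}^{n}rm_{r}}K(q^{\boldsymbol{m}+\boldsymbol{j}})\\ &\qquad\quad\times\prod_{r,s=1}^{n}\frac{(q^{-k_{s}+j_{r}}x_{r}/x_{s})_{m_{r}}}{(q^{1+j_{r}-j_{s}}x_{r}/x_{s})_{m_{r}}}\cdot\frac{(aq^{|\boldsymbol{k}|+|\boldsymbol{j}|},bq^{1+|\boldsymbol{j}|})_{|\boldsymbol{m}|}}{(aq)_{|\boldsymbol{m}|+|\boldsymbol{j}|}(bq^{2|\boldsymbol{j}|+1})_{|\boldsymbol{m}|}}.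 \end{aligned}$$
   Context: $q$ is a complex number with $0<|q|<1$ and $n\ge1$ is an integer. $(z)_\infty=\prod_{i\ge0}(1-zq^i)$ and $(z)_k=(z)_\infty/(zq^k)_\infty=\prod_{i=0}^{k-1}(1-zq^i)$ for integers $k\ge0$; $(a_1,\dots,a_p)_k=(a_1)_k\cdots(a_p)_k$. Bold letters denote multi-indices of nonnegative integers, $\boldsymbol k=(k_1,\dots,k_n)$, with $|\boldsymbol k|=k_1+\cdots+k_n$. $K(q^{\boldsymbol m+\boldsymbol j})$ means $K(q^{m_1+j_1},\dots,q^{m_n+j_n})$. If some $y_s=0$, the expression $\prod_{r,s}(x_r/(x_sy_s))_{k_r}(y_1\cdots y_n)^{|\boldsymbol k|}$, which is polynomial in the $y_s$, is understood by continuity. *)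

theory Defs
  imports "HOL-Analysis.Analysis"
begin

text \<open>
  A point of \<open>\<complex>\<^sup>n\<close> is an element of \<^term>\<open>{1..n} \<rightarrow>\<^sub>E (UNIV :: complex set)\<close>, and a multi-index is an
  element of \<^term>\<open>{1..n} \<rightarrow>\<^sub>E (UNIV :: nat set)\<close>.  Extensionality makes both unique, so that
  functions of \<open>n\<close> variables cannot depend on junk arguments and every multi-index is summed over
  exactly once.
\<close>

definition multi_indices :: "nat \<Rightarrow> (nat \<Rightarrow> nat) set" where
  "multi_indices n = {1..n} \<rightarrow>\<^sub>E UNIV"

definition msize :: "nat \<Rightarrow> (nat \<Rightarrow> nat) \<Rightarrow> nat" where
  "msize n k = (\<Sum>r=1..n. k r)"

definition yprod :: "nat \<Rightarrow> (nat \<Rightarrow> complex) \<Rightarrow> complex" where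
  "yprod n y = (\<Prod>r=1..n. y r)"

definition qpoch :: "complex \<Rightarrow> complex \<Rightarrow> nat \<Rightarrow> complex" where
  "qpoch q z k = (\<Prod>i<k. 1 - z * q ^ i)"

definition vdm_ratio :: "nat \<Rightarrow> complex \<Rightarrow> (nat \<Rightarrow> complex) \<Rightarrow> (nat \<Rightarrow> nat) \<Rightarrow> complex" where
  "vdm_ratio n q x j =
     (\<Prod>s=1..n. \<Prod>r=1..<s.
        (1 - q powi (int (j r) - int (j s)) * x r / x s) / (1 - x r / x s))"

definition y_factor_generic ::
  "nat \<Rightarrow> complex \<Rightarrow> (nat \<Rightarrow> complex) \<Rightarrow> (nat \<Rightarrow> complex) \<Rightarrow> (nat \<Rightarrow> nat) \<Rightarrow> complex" where
  "y_factor_generic n q x y k =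
     (\<Prod>r=1..n. \<Prod>s=1..n. qpoch q (x r / (x s * y s)) (k r)) * yprod n y ^ msize n k"

text \<open>Extension by continuity to points with some vanishing coordinate; the closed form is
  \<open>y_factor_poly\<close> below.\<close>

definition y_factor ::
  "nat \<Rightarrow> complex \<Rightarrow> (nat \<Rightarrow> complex) \<Rightarrow> (nat \<Rightarrow> complex) \<Rightarrow> (nat \<Rightarrow> nat) \<Rightarrow> complex" where
  "y_factor n q x y k =
     (if \<forall>s\<in>{1..n}. y s \<noteq> 0 then y_factor_generic n q x y k
      else Lim (at y within ({1..n} \<rightarrow>\<^sub>E - {0})) (\<lambda>z. y_factor_generic n q x z k))"

lemma y_factor_generic_poly:
  assumes "\<forall>s\<in>{1..n}. y s \<noteq> 0"
  shows "y_factor_generic n q x y k =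
           (\<Prod>r=1..n. \<Prod>s=1..n. \<Prod>i<k r. y s - q ^ i * x r / x s)"
proof -
  have "yprod n y ^ msize n k = (\<Prod>r=1..n. \<Prod>s=1..n. \<Prod>i<k r. y s)"
    by (simp add: yprod_def msize_def power_sum prod_power_distrib)
  then have "y_factor_generic n q x y k =
      (\<Prod>r=1..n. \<Prod>s=1..n. \<Prod>i<k r. (1 - x r / (x s * y s) * q ^ i) * y s)"
    by (simp add: y_factor_generic_def qpoch_def prod.distrib)
  also have "\<dots> = (\<Prod>r=1..n. \<Prod>s=1..n. \<Prod>i<k r. y s - q ^ i * x r / x s)"
    using assms by (intro prod.cong refl) (auto simp: field_simps)
  finally show ?thesis .
qed

lemma nonzero_points_limit_point:
  assumes "y \<in> {1..n} \<rightarrow>\<^sub>E (UNIV :: complex set)" and "\<not> (\<forall>s\<in>{1..n}. y s \<noteq> 0)"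
  shows "at y within ({1..n} \<rightarrow>\<^sub>E - {0}) \<noteq> bot"
proof -
  define z where
    "z = (\<lambda>m::nat. \<lambda>r. if r \<in> {1..n} \<and> y r = 0 then inverse (of_nat (Suc m)) else y r)"
  have z_in: "z m \<in> ({1..n} \<rightarrow>\<^sub>E - {0}) - {y}" for m
  proof -
    have "z m \<in> {1..n} \<rightarrow>\<^sub>E - {0}"
      using assms(1) by (auto simp: z_def PiE_def extensional_def simp del: of_nat_Suc)
    moreover have "z m \<noteq> y"
      using assms(2) calculation by auto
    ultimately show ?thesis by blast
  qed
  have "(\<lambda>m. z m r) \<longlonglongrightarrow> y r" for r
  proof (cases "r \<in> {1..n} \<and> y r = 0")
    case True
    then show ?thesis
      using LIMSEQ_Suc[OF lim_inverse_n] by (simp add: z_def del: of_nat_Suc)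
  next
    case False
    then show ?thesis by (auto simp: z_def)
  qed
  then have "z \<longlonglongrightarrow> y"
    using limitin_componentwise[of "\<lambda>_. euclidean" UNIV z y sequentially]
    by (simp add: euclidean_product_topology)
  then have "filterlim z (at y within ({1..n} \<rightarrow>\<^sub>E - {0})) sequentially"
    using z_in by (auto simp: filterlim_at)
  then show ?thesis
    by (metis filterlim_def filtermap_bot_iff le_bot sequentially_bot)
qed

lemma y_factor_poly:
  assumes "y \<in> {1..n} \<rightarrow>\<^sub>E UNIV"
  shows "y_factor n q x y k =
           (\<Prod>r=1..n. \<Prod>s=1..n. \<Prod>i<k r. y s - q ^ i * x r / x s)"
proof (cases "\<forall>s\<in>{1..n}. y s \<noteq> 0")
  case True
  then show ?thesis by (simp add: y_factor_def y_factor_generic_poly)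
next
  case False
  let ?F = "at y within ({1..n} \<rightarrow>\<^sub>E - {0})"
  let ?p = "\<lambda>z::nat \<Rightarrow> complex. \<Prod>r=1..n. \<Prod>s=1..n. \<Prod>i<k r. z s - q ^ i * x r / x s"
  have coord: "((\<lambda>z. z s) \<longlongrightarrow> y s) ?F" for s
    by (metis continuous_on_product_coordinates continuous_on_def UNIV_I tendsto_within_subset
        subset_UNIV)
  have "(?p \<longlongrightarrow> ?p y) ?F"
    by (intro tendsto_prod tendsto_diff tendsto_const coord)
  moreover have "eventually (\<lambda>z. ?p z = y_factor_generic n q x z k) ?F"
    unfolding eventually_at_filter
    by (intro always_eventually allI impI, subst y_factor_generic_poly) auto
  ultimately have "((\<lambda>z. y_factor_generic n q x z k) \<longlongrightarrow> ?p y) ?F"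
    by (rule Lim_transform_eventually)
  then have "Lim ?F (\<lambda>z. y_factor_generic n q x z k) = ?p y"
    using nonzero_points_limit_point[OF assms False] by (intro tendsto_Lim)
  then show ?thesis unfolding y_factor_def if_not_P[OF False] .
qed

definition lhs_term ::
  "nat \<Rightarrow> complex \<Rightarrow> complex \<Rightarrow> (nat \<Rightarrow> complex) \<Rightarrow> ((nat \<Rightarrow> nat) \<Rightarrow> complex)
     \<Rightarrow> (nat \<Rightarrow> complex) \<Rightarrow> (nat \<Rightarrow> nat) \<Rightarrow> complex" where
  "lhs_term n q b x \<beta> y j =
     vdm_ratio n q x j * y_factor n q x y j
     * ((1 - b * q ^ (2 * msize n j))
        / ((1 - b) * qpoch q (b * q * yprod n y) (msize n j)))
     * q ^ (\<Sum>r=1..n. (r - 1) * j r) * \<beta> j"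

definition rhs_m_term ::
  "nat \<Rightarrow> complex \<Rightarrow> complex \<Rightarrow> complex \<Rightarrow> (nat \<Rightarrow> complex) \<Rightarrow> ((nat \<Rightarrow> complex) \<Rightarrow> complex)
     \<Rightarrow> (nat \<Rightarrow> nat) \<Rightarrow> (nat \<Rightarrow> nat) \<Rightarrow> (nat \<Rightarrow> nat) \<Rightarrow> complex" where
  "rhs_m_term n q a b x K k j m =
     (\<Prod>s=1..n. \<Prod>r=1..<s.
        (1 - q powi (int (m r) - int (m s) + int (j r) - int (j s)) * x r / x s)
        / (1 - q powi (int (j r) - int (j s)) * x r / x s))
     * q ^ (\<Sum>r=1..n. r * m r) * K (\<lambda>r\<in>{1..n}. q ^ (m r + j r))
     * (\<Prod>r=1..n. \<Prod>s=1..n.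
          qpoch q (q powi (- int (k s) + int (j r)) * x r / x s) (m r)
          / qpoch q (q powi (1 + int (j r) - int (j s)) * x r / x s) (m r))
     * (qpoch q (a * q ^ (msize n k + msize n j)) (msize n m)
        * qpoch q (b * q ^ (1 + msize n j)) (msize n m)
        / (qpoch q (a * q) (msize n m + msize n j)
           * qpoch q (b * q ^ (2 * msize n j + 1)) (msize n m)))"

definition rhs_j_term ::
  "nat \<Rightarrow> complex \<Rightarrow> complex \<Rightarrow> complex \<Rightarrow> (nat \<Rightarrow> complex) \<Rightarrow> ((nat \<Rightarrow> complex) \<Rightarrow> complex)
     \<Rightarrow> ((nat \<Rightarrow> nat) \<Rightarrow> complex) \<Rightarrow> (nat \<Rightarrow> nat) \<Rightarrow> (nat \<Rightarrow> nat) \<Rightarrow> complex" where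
  "rhs_j_term n q a b x K \<beta> k j =
     vdm_ratio n q x j
     * (\<Prod>r=1..n. \<Prod>s=1..n. qpoch q (q powi (- int (k s)) * x r / x s) (j r))
     * (qpoch q (a * q ^ msize n k) (msize n j) * qpoch q (b * q) (msize n j)
        / qpoch q b (2 * msize n j))
     * (- 1) ^ msize n j * q ^ ((\<Sum>r=1..n. r * j r) + (msize n j choose 2)) * \<beta> j
     * (\<Sum>m \<in> (\<Pi>\<^sub>E r\<in>{1..n}. {0..k r - j r}). rhs_m_term n q a b x K k j m)"

definition rhs_term ::
  "nat \<Rightarrow> complex \<Rightarrow> complex \<Rightarrow> complex \<Rightarrow> (nat \<Rightarrow> complex) \<Rightarrow> ((nat \<Rightarrow> complex) \<Rightarrow> complex)
     \<Rightarrow> ((nat \<Rightarrow> nat) \<Rightarrow> complex) \<Rightarrow> (nat \<Rightarrow> complex) \<Rightarrow> (nat \<Rightarrow> nat) \<Rightarrow> complex" where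
  "rhs_term n q a b x K \<beta> y k =
     vdm_ratio n q x k
     * (y_factor n q x y k / (\<Prod>r=1..n. \<Prod>s=1..n. qpoch q (q * x r / x s) (k r)))
     * ((1 - a * q ^ (2 * msize n k)) * qpoch q a (msize n k)
        / ((1 - a) * qpoch q (a * q * yprod n y) (msize n k)))
     * q ^ (\<Sum>r=1..n. (r - 1) * k r)
     * (\<Sum>j \<in> (\<Pi>\<^sub>E r\<in>{1..n}. {0..k r}). rhs_j_term n q a b x K \<beta> k j)"

definition lhs ::
  "nat \<Rightarrow> complex \<Rightarrow> complex \<Rightarrow> (nat \<Rightarrow> complex) \<Rightarrow> ((nat \<Rightarrow> complex) \<Rightarrow> complex)
     \<Rightarrow> ((nat \<Rightarrow> nat) \<Rightarrow> complex) \<Rightarrow> (nat \<Rightarrow> complex) \<Rightarrow> complex" where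
  "lhs n q b x K \<beta> y = K y * (\<Sum>\<^sub>\<infinity>j\<in>multi_indices n. lhs_term n q b x \<beta> y j)"

definition rhs ::
  "nat \<Rightarrow> complex \<Rightarrow> complex \<Rightarrow> complex \<Rightarrow> (nat \<Rightarrow> complex) \<Rightarrow> ((nat \<Rightarrow> complex) \<Rightarrow> complex)
     \<Rightarrow> ((nat \<Rightarrow> nat) \<Rightarrow> complex) \<Rightarrow> (nat \<Rightarrow> complex) \<Rightarrow> complex" where
  "rhs n q a b x K \<beta> y = (\<Sum>\<^sub>\<infinity>k\<in>multi_indices n. rhs_term n q a b x K \<beta> y k)"

text \<open>
  The denominators of the identity, for all values of the summation indices.  The pairs \<open>(j, m)\<close>
  with \<open>j \<le> k\<close> and \<open>m \<le> k - j\<close> for some \<open>k\<close> are all pairs of multi-indices.  The denominators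
  \<open>x\<^sub>s y\<^sub>s\<close> contribute only \<open>x\<^sub>s \<noteq> 0\<close>, since \<open>y\<^sub>s = 0\<close> is allowed by continuity.
\<close>

definition no_denominator_vanishes ::
  "nat \<Rightarrow> complex \<Rightarrow> complex \<Rightarrow> complex \<Rightarrow> (nat \<Rightarrow> complex) \<Rightarrow> (nat \<Rightarrow> complex) \<Rightarrow> bool" where
  "no_denominator_vanishes n q a b x y \<longleftrightarrow>
     1 - a \<noteq> 0 \<and> 1 - b \<noteq> 0 \<and>
     (\<forall>s\<in>{1..n}. x s \<noteq> 0) \<and>
     (\<forall>s\<in>{1..n}. \<forall>r\<in>{1..<s}. 1 - x r / x s \<noteq> 0) \<and>
     (\<forall>k\<in>multi_indices n.
        qpoch q (a * q * yprod n y) (msize n k) \<noteq> 0 \<and>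
        (\<forall>r\<in>{1..n}. \<forall>s\<in>{1..n}. qpoch q (q * x r / x s) (k r) \<noteq> 0)) \<and>
     (\<forall>j\<in>multi_indices n.
        qpoch q (b * q * yprod n y) (msize n j) \<noteq> 0 \<and>
        qpoch q b (2 * msize n j) \<noteq> 0 \<and>
        (\<forall>s\<in>{1..n}. \<forall>r\<in>{1..<s}.
           1 - q powi (int (j r) - int (j s)) * x r / x s \<noteq> 0)) \<and>
     (\<forall>j\<in>multi_indices n. \<forall>m\<in>multi_indices n.
        (\<forall>r\<in>{1..n}. \<forall>s\<in>{1..n}.
           qpoch q (q powi (1 + int (j r) - int (j s)) * x r / x s) (m r) \<noteq> 0) \<and>
        qpoch q (a * q) (msize n m + msize n j) \<noteq> 0 \<and>
        qpoch q (b * q ^ (2 * msize n j + 1)) (msize n m) \<noteq> 0)"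

definition polydisc :: "nat \<Rightarrow> (nat \<Rightarrow> complex) \<Rightarrow> real \<Rightarrow> (nat \<Rightarrow> complex) set" where
  "polydisc n w R = (\<Pi>\<^sub>E r\<in>{1..n}. ball (w r) R)"

text \<open>Analyticity in \<open>n\<close> complex variables: local expansion into a convergent power series
  (for complex terms, \<^const>\<open>has_sum\<close> is absolute convergence).\<close>

definition multi_analytic_on ::
  "nat \<Rightarrow> ((nat \<Rightarrow> complex) \<Rightarrow> complex) \<Rightarrow> (nat \<Rightarrow> complex) set \<Rightarrow> bool" where
  "multi_analytic_on n f U \<longleftrightarrow>
     (\<forall>w\<in>U. \<exists>\<rho>>0. \<exists>c :: (nat \<Rightarrow> nat) \<Rightarrow> complex. \<forall>z\<in>polydisc n w \<rho>.
        ((\<lambda>\<alpha>. c \<alpha> * (\<Prod>r=1..n. (z r - w r) ^ \<alpha> r)) has_sum f z) (multi_indices n))"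

end

theory Submission
  imports Defs "HOL-Complex_Analysis.Conformal_Mappings"
begin

text \<open>
  At \<open>y\<^sub>r = q ^ N\<^sub>r\<close> both sides are finite, and comparing the coefficients of \<open>\<beta>(j) K(q\<^sup>l)\<close> reduces the
  identity to the evaluation of a sum over the multi-indices \<open>k\<close> between \<open>l\<close> and \<open>N\<close>.  A reversal
  formula for the \<open>A\<^sub>n\<close> products brings this sum to a terminating very well poised one with base
  point \<open>q\<^sup>l x\<close>.  Its terms depend on \<open>|k|\<close> alone up to the summand of Milne's fundamental theorem,
  so that it collapses to a one-variable sum, which telescopes to \<open>0\<close> unless \<open>l = N\<close>; the term
  \<open>l = N\<close> gives the left-hand side.  In the analytic case both sides agree at all these points, which
  accumulate at \<open>0\<close> in every coordinate, and the identity theorem applies one variable at a time.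
\<close>

section \<open>Partial fractions and a telescoping sum\<close>

text \<open>One sum over \<open>k\<close>, free of \<open>b\<close> and \<beta>, decides everything
  because the products in \<open>j\<close> and \<open>m\<close> fuse to products in
  \<open>l = j + m\<close>, for instance
  \<open>(a)_|k| (a q^|k|)_|j| (a q^(|k|+|j|))_|m| = (a)_(|k|+|l|)\<close>. The obstacle is that the
  factors \<open>(q^(-k_s) x_r / x_s)_(l_r)\<close> tie \<open>l\<close> to \<open>k\<close>. The
  reversal formula trades them for denominators at the base point \<open>q^l x\<close>, and the sum
  then has the form of the case \<open>l = 0\<close>, with \<open>a q^(2|l|)\<close> for
  \<open>a\<close> and \<open>N - l\<close> for \<open>N\<close>. Its value carries
  \<open>(q^(1-M))_M\<close> with \<open>M = |N - l|\<close>, which is zero for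
  \<open>M > 0\<close>. The denominator condition is posed at a single \<open>y\<close>, while the
  comparison takes place at all points \<open>q^N\<close>. The denominators there are built from
  \<open>1 - a\<close>, \<open>1 - a q^(i+1)\<close>, \<open>1 - b q^i\<close> and differences
  \<open>q^i x_r - q^j x_s\<close>, and that these do not vanish follows from the parts of the
  condition that are free of \<open>y\<close>.\<close>

lemma degree_coeff_prod_linear:
  fixes c :: "'i \<Rightarrow> 'a::field"
  assumes "finite I"
  shows "degree (\<Prod>s\<in>I. [:1, c s:]) \<le> card I \<and> coeff (\<Prod>s\<in>I. [:1, c s:]) (card I) = (\<Prod>s\<in>I. c s)"
  using assms
proof (induction I)
  case empty
  then show ?case by simp
next
  case (insert t I)
  let ?P = "\<Prod>s\<in>I. [:1, c s:]"
  have "degree ([:1, c t:] * ?P) \<le> degree [:1, c t:] + degree ?P"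
    by (rule degree_mult_le)
  also have "\<dots> \<le> Suc (card I)"
    using insert.IH by (simp add: degree_pCons_eq_if)
  finally have "degree ([:1, c t:] * ?P) \<le> Suc (card I)" .
  moreover have "coeff ?P (Suc (card I)) = 0"
    using insert.IH by (simp add: coeff_eq_0)
  ultimately show ?case
    using insert by simp
qed

text \<open>Lagrange interpolation of \<open>\<Prod>s. 1 - t / Z s\<close> at the nodes
  \<open>Y r\<close>, evaluated at \<open>t = 0\<close>. The degree may be \<open>card I\<close>,
  one too many for \<open>card I\<close> nodes; a multiple of the nodal polynomial accounts for the
  top coefficient and produces the product on the right.\<close>

lemma partial_fraction_sum:
  fixes Y Z :: "'i \<Rightarrow> 'a::field"
  assumes fin: "finite I" and inj: "inj_on Y I" and nz: "\<And>s. s \<in> I \<Longrightarrow> Y s \<noteq> 0"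
  shows "(\<Sum>r\<in>I. (\<Prod>s\<in>I. 1 - Y r / Z s) / (\<Prod>s\<in>I-{r}. 1 - Y r / Y s)) = 1 - (\<Prod>s\<in>I. Y s / Z s)"
proof -
  define L where "L c J = (\<Prod>s\<in>J. [:1, - (1 / c s):])" for c :: "'i \<Rightarrow> 'a" and J
  have poly_L: "poly (L c J) t = (\<Prod>s\<in>J. 1 - t / c s)" for c J t
    by (simp add: L_def poly_prod)
  have L_bounds: "degree (L c J) \<le> card J" "coeff (L c J) (card J) = (\<Prod>s\<in>J. - (1 / c s))"
    if "finite J" for c J
    using degree_coeff_prod_linear[OF that, of "\<lambda>s. - (1 / c s)"] by (auto simp: L_def)
  define w where "w r = poly (L Z I) (Y r) / (\<Prod>s\<in>I-{r}. 1 - Y r / Y s)" for r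
  define C where "C = (\<Prod>s\<in>I. Y s / Z s)"
  \<comment> \<open>\<open>L Y (I - {r})\<close> vanishes at every node but \<open>Y r\<close>, and
    \<open>w r\<close> is the matching interpolation weight. \<open>C\<close> is the ratio of the
    coefficients of \<open>t ^ card I\<close> in \<open>L Z I\<close> and
    \<open>L Y I\<close>.\<close>
  define Q where "Q = (\<Sum>r\<in>I. smult (w r) (L Y (I - {r}))) + smult C (L Y I)"
  have deg: "degree (smult (w r) (L Y (I - {r}))) < card I" if "r \<in> I" for r
  proof -
    have "degree (smult (w r) (L Y (I - {r}))) \<le> card (I - {r})"
      using L_bounds(1)[of "I - {r}" Y] fin degree_smult_le[of "w r" "L Y (I - {r})"] by simp
    also have "\<dots> < card I"
      using fin that by (intro psubset_card_mono) auto
    finally show ?thesis .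
  qed
  have degQ: "degree Q \<le> card I"
    unfolding Q_def using deg L_bounds(1)[OF fin, of Y] degree_smult_le[of C "L Y I"]
    by (intro degree_add_le degree_sum_le fin) (auto simp: less_imp_le)
  have coeffQ: "coeff (L Z I) (card I) = coeff Q (card I)"
  proof -
    have "coeff Q (card I) = C * (\<Prod>s\<in>I. - (1 / Y s))"
      using deg L_bounds(2)[OF fin, of Y] by (simp add: Q_def coeff_sum coeff_eq_0 del: coeff_smult)
         (simp add: coeff_smult)
    also have "\<dots> = (\<Prod>s\<in>I. - (1 / Z s))"
      unfolding C_def prod.distrib[symmetric] using nz by (intro prod.cong) auto
    finally show ?thesis using L_bounds(2)[OF fin, of Z] by simp
  qed
  have "L Z I = Q"
  proof (rule poly_eqI_degree_lead_coeff[OF coeffQ, of "Y ` I"])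
    show "card I \<le> card (Y ` I)" using inj by (simp add: card_image)
    fix t assume "t \<in> Y ` I"
    then obtain r where r: "r \<in> I" "t = Y r" by auto
    have zero: "poly (L Y J) (Y r) = 0" if "r \<in> J" "finite J" for J
      using that r nz by (auto simp: poly_L intro!: prod_zero bexI[of _ r])
    have "poly Q t = (\<Sum>r'\<in>I. w r' * poly (L Y (I - {r'})) t)"
      using zero[of I] r fin by (simp add: Q_def poly_sum)
    also have "\<dots> = (\<Sum>r'\<in>I. if r' = r then w r * poly (L Y (I - {r})) t else 0)"
      using zero r fin by (intro sum.cong) auto
    also have "\<dots> = w r * (\<Prod>s\<in>I-{r}. 1 - Y r / Y s)"
      using r fin by (simp add: poly_L)
    also have "(\<Prod>s\<in>I-{r}. 1 - Y r / Y s) \<noteq> 0"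
      using fin inj nz r by (auto simp: inj_on_def)
    then have "w r * (\<Prod>s\<in>I-{r}. 1 - Y r / Y s) = poly (L Z I) t"
      by (simp add: w_def r)
    finally show "poly (L Z I) t = poly Q t" ..
  qed (use L_bounds(1)[OF fin, of Z] degQ in auto)
  then have "poly (L Z I) 0 = poly Q 0" by simp
  then have "1 = (\<Sum>r\<in>I. w r) + C"
    by (simp add: Q_def poly_sum poly_L)
  then show ?thesis
    by (simp add: w_def C_def poly_L algebra_simps)
qed

section \<open>q-shifted factorials and an indefinite very well poised sum\<close>

lemma qpoch_0 [simp]: "qpoch q z 0 = 1"
  by (simp add: qpoch_def)

lemma qpoch_Suc: "qpoch q z (Suc k) = qpoch q z k * (1 - z * q ^ k)"
  by (simp add: qpoch_def)

lemma qpoch_add: "qpoch q z (k + l) = qpoch q z k * qpoch q (z * q ^ k) l"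
  by (induction l) (simp_all add: qpoch_Suc power_add mult.assoc)

lemma qpoch_Suc_shift: "qpoch q z (Suc k) = (1 - z) * qpoch q (z * q) k"
  using qpoch_add[of q z 1 k] by (simp add: qpoch_Suc)

lemma qpoch_eq_0_iff: "qpoch q z k = 0 \<longleftrightarrow> (\<exists>i<k. z * q ^ i = 1)"
  by (auto simp: qpoch_def)

text \<open>The summand is very well poised with the pairs \<open>a, q\<close> and
  \<open>q^(-m), a q^(m+1)\<close>; with the argument \<open>q^m\<close> all partial sums factor.
  For \<open>J = m > 0\<close> the factor \<open>qpoch q (q / q ^ m) J\<close> makes the sum
  vanish.\<close>

lemma very_well_poised_partial_sum:
  assumes "q \<noteq> 0" "\<And>i. q ^ Suc i \<noteq> 1" "\<And>i. a * q ^ Suc i \<noteq> 1"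
  shows "(\<Sum>k\<le>J. (1 - a * q ^ (2 * k)) * qpoch q a k * (qpoch q (1 / q ^ m) k / qpoch q q k)
             / qpoch q (a * q ^ Suc m) k * q ^ (m * k))
         = (1 - a) * (qpoch q (a * q) J * qpoch q (q / q ^ m) J * q ^ (m * J))
             / (qpoch q q J * qpoch q (a * q ^ Suc m) J)"
proof (induction J)
  case 0
  then show ?case by simp
next
  case (Suc J)
  \<comment> \<open>With \<open>u = q^J\<close>, \<open>v = q^m\<close> and the other products as
    independent symbols, the induction step is a rational identity.\<close>
  define A where "A = qpoch q (a * q) J"
  define v where "v = q ^ m"
  define B where "B = qpoch q (q / v) J"
  define C where "C = qpoch q q J"
  define D where "D = qpoch q (a * (q * v)) J"
  define u where "u = q ^ J"
  define E where "E = q ^ (m * J)"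
  have nz: "C \<noteq> 0" "D \<noteq> 0" "v \<noteq> 0" "1 - q * u \<noteq> 0" "1 - a * (q * v) * u \<noteq> 0"
    using assms(1) assms(2) assms(3)[of "m + _"]
    by (auto simp: C_def D_def u_def v_def qpoch_eq_0_iff power_add mult_ac)
  have "(1 - a) * (A * B * E) / (C * D)
      + (1 - a * (q * u)\<^sup>2) * ((1 - a) * A) * ((1 - 1 / v) * B / (C * (1 - q * u)))
          / (D * (1 - a * (q * v) * u)) * (E * v)
      = (1 - a) * (A * (1 - a * q * u) * (B * (1 - q / v * u)) * (E * v))
          / (C * (1 - q * u) * (D * (1 - a * (q * v) * u)))"
    using nz by (simp add: divide_simps) (simp add: algebra_simps power2_eq_square)
  moreover have "qpoch q a (Suc J) = (1 - a) * A"
    by (simp add: qpoch_Suc_shift A_def)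
  moreover have "qpoch q (1 / q ^ m) (Suc J) = (1 - 1 / v) * B"
    by (simp add: qpoch_Suc_shift B_def v_def)
  moreover have "q ^ (2 * Suc J) = (q * u)\<^sup>2" "q ^ (m * Suc J) = E * v"
    by (simp_all add: u_def E_def v_def mult.commute mult_2_right power2_eq_square power_add)
  ultimately show ?case
    unfolding sum.atMost_Suc Suc.IH
    by (simp add: qpoch_Suc A_def[symmetric] B_def[symmetric] C_def[symmetric] D_def[symmetric]
          u_def[symmetric] v_def[symmetric] E_def[symmetric] del: power_mult)
qed

section \<open>Milne's fundamental theorem\<close>

text \<open>Numerators and denominators of the identity share this form:
  \<open>z s = x s * y s\<close> gives \<open>(x_r / (x_s y_s))_(k_r)\<close>, while
  \<open>\<lambda>r. q * x r\<close> over \<open>x\<close> gives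
  \<open>(q x_r / x_s)_(k_r)\<close>.\<close>

definition qpoch_prod ::
  "complex \<Rightarrow> 'i set \<Rightarrow> ('i \<Rightarrow> complex) \<Rightarrow> ('i \<Rightarrow> complex) \<Rightarrow> ('i \<Rightarrow> nat) \<Rightarrow> complex" where
  "qpoch_prod q I x z k = (\<Prod>r\<in>I. \<Prod>s\<in>I. qpoch q (x r / z s) (k r))"

definition qshift :: "complex \<Rightarrow> ('i \<Rightarrow> nat) \<Rightarrow> ('i \<Rightarrow> complex) \<Rightarrow> 'i \<Rightarrow> complex" where
  "qshift q k x = (\<lambda>r. q ^ k r * x r)"

text \<open>Quotient of the Vandermonde products in \<open>y\<close> and in \<open>x\<close>.
  Exchanging \<open>r\<close> and \<open>s\<close> does not change a factor, so the order on the
  indices only serves to count each pair once.\<close>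

definition vdm_quot :: "'i::linorder set \<Rightarrow> ('i \<Rightarrow> complex) \<Rightarrow> ('i \<Rightarrow> complex) \<Rightarrow> complex" where
  "vdm_quot I x y = (\<Prod>s\<in>I. \<Prod>r\<in>{r\<in>I. r < s}. (y s - y r) / (x s - x r))"

text \<open>As \<open>g\<close> is symmetric, the pairs with \<open>t\<close> as larger and as
  smaller element merge into one product over \<open>J\<close>. Hence any index can be split off,
  wherever it stands in the order.\<close>

lemma prod_pairs_insert:
  fixes g :: "'i::linorder \<Rightarrow> 'i \<Rightarrow> 'a::comm_monoid_mult"
  assumes "finite J" "t \<notin> J" and sym: "\<And>r s. g r s = g s r"
  shows "(\<Prod>s\<in>insert t J. \<Prod>r\<in>{r\<in>insert t J. r < s}. g r s)
           = (\<Prod>s\<in>J. g s t) * (\<Prod>s\<in>J. \<Prod>r\<in>{r\<in>J. r < s}. g r s)"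
proof -
  have "{r\<in>insert t J. r < t} = {r\<in>J. r < t}" by auto
  then have 1: "(\<Prod>r\<in>{r\<in>insert t J. r < t}. g r t) = (\<Prod>s\<in>J. if s < t then g s t else 1)"
    using assms(1) by (simp add: prod.inter_filter)
  have "(\<Prod>r\<in>{r\<in>insert t J. r < s}. g r s)
      = (if t < s then g s t else 1) * (\<Prod>r\<in>{r\<in>J. r < s}. g r s)" for s
  proof (cases "t < s")
    case True
    then have "{r\<in>insert t J. r < s} = insert t {r\<in>J. r < s}" by auto
    with True show ?thesis using assms by (simp add: sym[of t s])
  next
    case False
    then have "{r\<in>insert t J. r < s} = {r\<in>J. r < s}" by auto
    with False show ?thesis by simp
  qed
  then have "(\<Prod>s\<in>J. \<Prod>r\<in>{r\<in>insert t J. r < s}. g r s)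
     = (\<Prod>s\<in>J. if t < s then g s t else 1) * (\<Prod>s\<in>J. \<Prod>r\<in>{r\<in>J. r < s}. g r s)"
    by (simp add: prod.distrib)
  moreover have "(\<Prod>s\<in>J. if s < t then g s t else 1) * (\<Prod>s\<in>J. if t < s then g s t else 1)
     = (\<Prod>s\<in>J. g s t)"
    unfolding prod.distrib[symmetric] using assms(2) by (intro prod.cong) auto
  ultimately show ?thesis
    using assms 1 by (simp add: mult.assoc[symmetric])
qed

lemma vdm_quot_insert:
  assumes "finite J" "t \<notin> J"
  shows "vdm_quot (insert t J) x y = (\<Prod>s\<in>J. (y s - y t) / (x s - x t)) * vdm_quot J x y"
proof -
  define g where "g r s = (y s - y r) / (x s - x r)" for r s
  have sym: "g r s = g s r" for r s
    by (metis g_def minus_diff_eq minus_divide_divide)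
  show ?thesis
    using prod_pairs_insert[OF assms, of g, OF sym]
    by (simp add: vdm_quot_def g_def[symmetric] sym[of t])
qed

lemma vdm_quot_cong:
  assumes "\<And>r. r \<in> I \<Longrightarrow> x r = x' r" "\<And>r. r \<in> I \<Longrightarrow> y r = y' r"
  shows "vdm_quot I x y = vdm_quot I x' y'"
  unfolding vdm_quot_def using assms by (intro prod.cong) auto

lemma vdm_quot_update:
  assumes "finite I" "t \<in> I" and "\<And>s. s \<in> I - {t} \<Longrightarrow> y s \<noteq> y t"
  shows "vdm_quot I x (y(t := u)) = vdm_quot I x y * (\<Prod>s\<in>I-{t}. (y s - u) / (y s - y t))"
proof -
  define J where "J = I - {t}"
  have J: "I = insert t J" "finite J" "t \<notin> J"
    using assms by (auto simp: J_def)
  have "(\<Prod>s\<in>J. (y s - u) / (x s - x t))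
      = (\<Prod>s\<in>J. (y s - y t) / (x s - x t)) * (\<Prod>s\<in>J. (y s - u) / (y s - y t))"
    unfolding prod.distrib[symmetric] using assms(3) by (intro prod.cong) (auto simp: J_def)
  moreover have "vdm_quot J x (y(t := u)) = vdm_quot J x y"
    using J by (intro vdm_quot_cong) auto
  moreover have "(\<Prod>s\<in>J. ((y(t := u)) s - (y(t := u)) t) / (x s - x t))
      = (\<Prod>s\<in>J. (y s - u) / (x s - x t))"
    using J by (intro prod.cong) auto
  ultimately show ?thesis
    unfolding J(1) vdm_quot_insert[OF J(2,3)] using J(3) by simp
qed

text \<open>Used to change the base point from \<open>x\<close> to \<open>q^l x\<close>.\<close>

lemma vdm_quot_trans:
  assumes "finite I" "inj_on y I"
  shows "vdm_quot I x y * vdm_quot I y z = vdm_quot I x z"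
  unfolding vdm_quot_def prod.distrib[symmetric]
  using assms by (intro prod.cong) (auto simp: inj_on_def)

lemma vdm_quot_self:
  assumes "inj_on x I"
  shows "vdm_quot I x x = 1"
  unfolding vdm_quot_def using assms by (intro prod.neutral ballI) (auto simp: inj_on_def)

lemma qpoch_prod_update_Suc:
  assumes "finite I" "t \<in> I"
  shows "qpoch_prod q I x z (k(t := Suc (k t)))
           = qpoch_prod q I x z k * (\<Prod>s\<in>I. 1 - q ^ k t * x t / z s)"
proof -
  have "qpoch_prod q I x z (k(t := Suc (k t)))
      = (\<Prod>r\<in>I. (\<Prod>s\<in>I. qpoch q (x r / z s) (k r)) *
                (if r = t then \<Prod>s\<in>I. 1 - q ^ k t * x t / z s else 1))"
    unfolding qpoch_prod_def
    by (intro prod.cong) (auto simp: qpoch_Suc prod.distrib mult_ac)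
  then show ?thesis
    using assms by (simp add: prod.distrib qpoch_prod_def)
qed

lemma qpoch_prod_add:
  "qpoch_prod q I x z (\<lambda>r. k r + l r)
     = qpoch_prod q I x z k * qpoch_prod q I (qshift q k x) z l"
  by (simp add: qpoch_prod_def qpoch_add prod.distrib qshift_def mult_ac)

lemma qpoch_prod_cong:
  assumes "\<And>r. r \<in> I \<Longrightarrow> x r = x' r" "\<And>r. r \<in> I \<Longrightarrow> z r = z' r" "\<And>r. r \<in> I \<Longrightarrow> k r = k' r"
  shows "qpoch_prod q I x z k = qpoch_prod q I x' z' k'"
  unfolding qpoch_prod_def using assms by (intro prod.cong) auto

lemma qpoch_prod_0: "(\<And>r. r \<in> I \<Longrightarrow> k r = 0) \<Longrightarrow> qpoch_prod q I x z k = 1"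
  unfolding qpoch_prod_def by (intro prod.neutral ballI) auto

text \<open>One condition behind all denominators in \<open>x\<close>: the numbers
  \<open>q^i x_r\<close> are pairwise distinct. It forces \<open>x_r\<close> to be nonzero and, as
  \<open>I\<close> is nonempty, prevents \<open>q\<close> from being a root of unity. It passes to
  \<open>qshift q l x\<close>, as the change of base point requires.\<close>

locale q_generic =
  fixes q :: complex and I :: "'i::linorder set" and x :: "'i \<Rightarrow> complex"
  assumes fin: "finite I" and nonempty: "I \<noteq> {}" and q_nz: "q \<noteq> 0"
    and inj: "inj_on (\<lambda>(r, i::nat). q ^ i * x r) (I \<times> UNIV)"
begin

lemma q_generic_eq_iff:
  "r \<in> I \<Longrightarrow> s \<in> I \<Longrightarrow> q ^ i * x r = q ^ j * x s \<longleftrightarrow> r = s \<and> i = j"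
  using inj_onD[OF inj, of "(r, i)" "(s, j)"] by auto

lemma x_nz: "r \<in> I \<Longrightarrow> x r \<noteq> 0"
  using q_generic_eq_iff[of r r 0 1] by auto

lemma q_pow_neq_1: "q ^ Suc i \<noteq> 1"
proof
  obtain r where "r \<in> I" using nonempty by auto
  assume "q ^ Suc i = 1"
  then have "q ^ Suc i * x r = q ^ 0 * x r" by simp
  with q_generic_eq_iff[OF \<open>r \<in> I\<close> \<open>r \<in> I\<close>, of "Suc i" 0] show False by simp
qed

lemma qpoch_q_nz: "qpoch q q k \<noteq> 0"
  using q_pow_neq_1 by (auto simp: qpoch_eq_0_iff)

lemma inj_qshift: "inj_on (qshift q k x) I"
  by (rule inj_onI) (auto simp: qshift_def q_generic_eq_iff)

lemma inj_x: "inj_on x I"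
  using inj_qshift[of "\<lambda>_. 0"] by (simp add: qshift_def)

lemma qshift_nz: "r \<in> I \<Longrightarrow> qshift q k x r \<noteq> 0"
  using x_nz q_nz by (simp add: qshift_def)

lemma q_generic_qshift: "q_generic q I (qshift q l x)"
proof
  show "inj_on (\<lambda>(r, i). q ^ i * qshift q l x r) (I \<times> UNIV)"
    by (rule inj_onI) (auto simp: qshift_def mult.assoc[symmetric] power_add[symmetric] q_generic_eq_iff)
qed (use fin nonempty q_nz in auto)

lemma qpoch_prod_den_nz: "qpoch_prod q I (\<lambda>r. q * x r) x k \<noteq> 0"
proof -
  have "q * x r / x s * q ^ i \<noteq> 1" if "r \<in> I" "s \<in> I" for r s i
    using q_generic_eq_iff[OF that, of "Suc i" 0] x_nz[OF that(2)] by (auto simp: field_simps)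
  then show ?thesis
    using fin by (auto simp: qpoch_prod_def qpoch_eq_0_iff)
qed

text \<open>The summand of the multiple series that Milne's theorem evaluates on each level
  \<open>|k| = K\<close>; in the transformation \<open>z\<close> is
  \<open>qshift q N x\<close>.\<close>

definition milne_term :: "('i \<Rightarrow> complex) \<Rightarrow> ('i \<Rightarrow> nat) \<Rightarrow> complex" where
  "milne_term z k = vdm_quot I x (qshift q k x) * qpoch_prod q I x z k
                      / qpoch_prod q I (\<lambda>r. q * x r) x k"

lemma vdm_quot_qshift_update:
  assumes "t \<in> I"
  shows "vdm_quot I w (qshift q (k(t := Suc (k t))) x)
       = vdm_quot I w (qshift q k x)
         * (\<Prod>s\<in>I-{t}. (qshift q k x s - q * qshift q k x t) / (qshift q k x s - qshift q k x t))"
proof -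
  have "qshift q (k(t := Suc (k t))) x = (qshift q k x)(t := q * qshift q k x t)"
    by (auto simp: qshift_def)
  moreover have "qshift q k x s \<noteq> qshift q k x t" if "s \<in> I - {t}" for s
    using that assms by (auto simp: qshift_def q_generic_eq_iff)
  ultimately show ?thesis
    using vdm_quot_update[OF fin assms, of "qshift q k x"] by simp
qed

text \<open>The ratio of neighbouring terms is a quotient of two partial fraction weights: the one
  with \<open>z\<close> at the old index over the one with \<open>x\<close> at the new index. This
  links consecutive levels of \<open>|k|\<close>.\<close>

lemma milne_term_update:
  fixes k z t
  defines "Y \<equiv> qshift q k x" and "Y' \<equiv> qshift q (k(t := Suc (k t))) x"
  assumes t: "t \<in> I"
  shows "milne_term z (k(t := Suc (k t)))
           * ((\<Prod>s\<in>I. 1 - Y' t / x s) / (\<Prod>s\<in>I-{t}. 1 - Y' t / Y' s))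
         = milne_term z k * ((\<Prod>s\<in>I. 1 - Y t / z s) / (\<Prod>s\<in>I-{t}. 1 - Y t / Y s))"
proof -
  have Y't: "Y' t = q * Y t" by (simp add: Y_def Y'_def qshift_def)
  have Y's: "Y' s = Y s" if "s \<in> I - {t}" for s
    using that by (simp add: Y_def Y'_def qshift_def)
  have Ynz: "Y s \<noteq> 0" if "s \<in> I" for s
    using qshift_nz[OF that] by (simp add: Y_def)
  have neq: "Y s \<noteq> Y t" "Y s \<noteq> q * Y t" if "s \<in> I - {t}" for s
    using that t q_generic_eq_iff[of s t "k s" "k t"] q_generic_eq_iff[of s t "k s" "Suc (k t)"]
    by (auto simp: Y_def qshift_def mult.assoc)
  have neq1: "q * Y t \<noteq> x s" if "s \<in> I" for s
    using that t q_generic_eq_iff[of t s "Suc (k t)" 0] by (auto simp: Y_def qshift_def mult.assoc)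
  define V where "V = (\<Prod>s\<in>I-{t}. (Y s - q * Y t) / (Y s - Y t))"
  define A where "A = (\<Prod>s\<in>I. 1 - Y t / z s)"
  define B where "B = (\<Prod>s\<in>I. 1 - q * Y t / x s)"
  define C where "C = (\<Prod>s\<in>I-{t}. 1 - q * Y t / Y s)"
  define D where "D = (\<Prod>s\<in>I-{t}. 1 - Y t / Y s)"
  have B: "B \<noteq> 0" using fin neq1 x_nz by (fastforce simp: B_def field_simps)
  have C: "C \<noteq> 0" using fin neq Ynz by (auto simp: C_def field_simps)
  \<comment> \<open>The Vandermonde quotient changes exactly by the ratio of the denominators of the
    two weights.\<close>
  have "V * D = C"
    unfolding V_def C_def D_def prod.distrib[symmetric]
  proof (intro prod.cong refl)
    fix s assume "s \<in> I - {t}"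
    with neq[of s] Ynz[of s]
    show "(Y s - q * Y t) / (Y s - Y t) * (1 - Y t / Y s) = 1 - q * Y t / Y s"
      by (simp add: field_simps)
  qed
  moreover have D: "D \<noteq> 0" using fin neq Ynz by (auto simp: D_def field_simps)
  ultimately have V: "V = C / D" by (simp add: field_simps)
  have "vdm_quot I x Y' = vdm_quot I x Y * V"
    using vdm_quot_qshift_update[OF t] by (simp add: Y_def Y'_def V_def)
  moreover have "qpoch_prod q I x z (k(t := Suc (k t))) = qpoch_prod q I x z k * A"
    using qpoch_prod_update_Suc[OF fin t] by (simp add: A_def Y_def qshift_def)
  moreover have "qpoch_prod q I (\<lambda>r. q * x r) x (k(t := Suc (k t)))
      = qpoch_prod q I (\<lambda>r. q * x r) x k * B"
    using qpoch_prod_update_Suc[OF fin t, of q "\<lambda>r. q * x r"]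
    by (simp add: B_def Y_def qshift_def mult_ac)
  moreover have "(\<Prod>s\<in>I. 1 - Y' t / x s) = B" by (simp add: Y't B_def)
  moreover have "(\<Prod>s\<in>I-{t}. 1 - Y' t / Y' s) = C"
    unfolding C_def using Y's by (intro prod.cong) (auto simp: Y't)
  moreover have "v * (C / D) * (p * A) / (e * B) * (B / C) = v * p / e * (A / D)" for v p e
    using B C by (simp add: mult_ac)
  ultimately show ?thesis
    unfolding milne_term_def Y_def[symmetric] Y'_def[symmetric] A_def[symmetric] D_def[symmetric] V
    by simp
qed

lemma finite_size_eq: "finite {k \<in> I \<rightarrow>\<^sub>E (UNIV :: nat set). sum k I = K}"
proof (rule finite_subset)
  show "{k \<in> I \<rightarrow>\<^sub>E UNIV. sum k I = K} \<subseteq> I \<rightarrow>\<^sub>E {..K}"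
    using member_le_sum[OF _ _ fin] by (auto simp: PiE_def Pi_def)
qed (use fin in \<open>simp add: finite_PiE\<close>)

lemma sum_fun_upd_Suc: "t \<in> I \<Longrightarrow> sum (k(t := Suc (k t))) I = Suc (sum k I)"
  for k :: "'i \<Rightarrow> nat"
  using fin by (simp add: sum.remove[of I t])

text \<open>The weights of the first partial fraction expansion vanish when
  \<open>k\<^sub>r = 0\<close> and turn the sum over \<open>|k| = K + 1\<close> into one over \<open>|k| = K\<close>.\<close>

theorem milne_fundamental:
  "(\<Sum>k | k \<in> I \<rightarrow>\<^sub>E UNIV \<and> sum k I = K. milne_term z k)
     = qpoch q (\<Prod>s\<in>I. x s / z s) K / qpoch q q K"
proof (induction K)
  case 0
  define zero where "zero = (\<lambda>r\<in>I. 0::nat)"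
  have "{k. k \<in> I \<rightarrow>\<^sub>E UNIV \<and> sum k I = 0} = {zero}"
    using fin by (auto simp: fun_eq_iff PiE_def extensional_def zero_def)
  moreover have "milne_term z zero = 1"
  proof -
    have "vdm_quot I x (qshift q zero x) = vdm_quot I x x"
      by (rule vdm_quot_cong) (auto simp: qshift_def zero_def)
    then show ?thesis
      using vdm_quot_self[OF inj_x] by (simp add: milne_term_def qpoch_prod_0 zero_def)
  qed
  ultimately show ?case by simp
next
  case (Suc K)
  define S where "S K = {k. k \<in> I \<rightarrow>\<^sub>E UNIV \<and> sum k I = K}" for K :: nat
  have finS: "finite (S K)" for K
    using finite_size_eq by (simp add: S_def)
  \<comment> \<open>Partial fraction weights at the points \<open>q^k x\<close>. With
    \<open>c = x\<close> they add up to \<open>1 - q^|k|\<close>, with \<open>c = z\<close> to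
    \<open>1 - (\<Prod>s. x s / z s) q^|k|\<close>; these become the two factors of the recursion in
    \<open>K\<close>.\<close>
  define w where "w c k r = (\<Prod>s\<in>I. 1 - qshift q k x r / c s)
      / (\<Prod>s\<in>I-{r}. 1 - qshift q k x r / qshift q k x s)" for c k r
  have w_sum: "(\<Sum>r\<in>I. w c k r) = 1 - (\<Prod>s\<in>I. x s / c s) * q ^ sum k I" for c k
  proof -
    have "(\<Sum>r\<in>I. w c k r) = 1 - (\<Prod>s\<in>I. qshift q k x s / c s)"
      unfolding w_def using inj_qshift qshift_nz by (intro partial_fraction_sum[OF fin])
    also have "(\<Prod>s\<in>I. qshift q k x s / c s) = (\<Prod>s\<in>I. x s / c s) * q ^ sum k I"
      by (simp add: qshift_def power_sum prod.distrib[symmetric] mult_ac)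
    finally show ?thesis .
  qed
  have w_0: "w x k r = 0" if "r \<in> I" "k r = 0" for k r
  proof -
    have "(\<Prod>s\<in>I. 1 - qshift q k x r / x s) = 0"
      using fin that x_nz by (intro prod_zero bexI[of _ r]) (auto simp: qshift_def)
    then show ?thesis by (simp add: w_def)
  qed
  have "(1 - q ^ Suc K) * (\<Sum>k\<in>S (Suc K). milne_term z k)
      = (\<Sum>k\<in>S (Suc K). \<Sum>r\<in>I. milne_term z k * w x k r)"
    unfolding sum_distrib_left
  proof (intro sum.cong refl)
    fix k assume "k \<in> S (Suc K)"
    then have "(\<Sum>r\<in>I. w x k r) = 1 - q ^ Suc K"
      unfolding w_sum using x_nz by (simp add: S_def)
    then show "(1 - q ^ Suc K) * milne_term z k = (\<Sum>r\<in>I. milne_term z k * w x k r)"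
      by (simp add: sum_distrib_left[symmetric])
  qed
  also have "\<dots> = (\<Sum>(k, r)\<in>Sigma (S (Suc K)) (\<lambda>_. I). milne_term z k * w x k r)"
    using finS fin by (intro sum.Sigma) auto
  also have "\<dots> = (\<Sum>(k, r)\<in>Sigma (S (Suc K)) (\<lambda>k. {r\<in>I. k r \<noteq> 0}). milne_term z k * w x k r)"
    using finS fin by (intro sum.mono_neutral_right) (auto intro!: gr0I dest: w_0)
  \<comment> \<open>Lower \<open>k r\<close> by one. The pair keeps \<open>r\<close>, which makes
    this a bijection once the pairs with \<open>k r = 0\<close> are gone.\<close>
  also have "\<dots> = (\<Sum>(k, r)\<in>Sigma (S K) (\<lambda>_. I). milne_term z k * w z k r)"
  proof (intro sum.reindex_bij_witness
      [where j = "\<lambda>(k, r). (k(r := k r - 1), r)" and i = "\<lambda>(k, r). (k(r := Suc (k r)), r)"])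
    fix p assume "p \<in> Sigma (S (Suc K)) (\<lambda>k. {r\<in>I. k r \<noteq> 0})"
    then obtain k r where p: "p = (k, r)" "k \<in> S (Suc K)" "r \<in> I" "k r \<noteq> 0" by auto
    define k' where "k' = k(r := k r - 1)"
    have k: "k = k'(r := Suc (k' r))" using p by (auto simp: k'_def)
    then have "sum k I = Suc (sum k' I)" using sum_fun_upd_Suc p(3) by metis
    then have "k' \<in> S K" using p by (auto simp: S_def k'_def PiE_def extensional_def)
    then show "(case p of (k, r) \<Rightarrow> (k(r := k r - 1), r)) \<in> S K \<times> I"
      using p by (simp add: k'_def)
    show "(case case p of (k, r) \<Rightarrow> (k(r := k r - 1), r) of (k, r) \<Rightarrow> (k(r := Suc (k r)), r)) = p"
      using p by auto
    show "(case case p of (k, r) \<Rightarrow> (k(r := k r - 1), r) of (k, r) \<Rightarrow> milne_term z k * w z k r)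
        = (case p of (k, r) \<Rightarrow> milne_term z k * w x k r)"
      using milne_term_update[OF p(3), of z k', folded k] by (simp add: p(1) w_def k'_def[unfolded One_nat_def, symmetric])
  next
    fix p assume "p \<in> S K \<times> I"
    then obtain k r where p: "p = (k, r)" "k \<in> S K" "r \<in> I" by auto
    then show "(case case p of (k, r) \<Rightarrow> (k(r := Suc (k r)), r) of (k, r) \<Rightarrow> (k(r := k r - 1), r)) = p"
      by simp
    show "(case p of (k, r) \<Rightarrow> (k(r := Suc (k r)), r)) \<in> Sigma (S (Suc K)) (\<lambda>k. {r\<in>I. k r \<noteq> 0})"
      using p sum_fun_upd_Suc[OF p(3)] by (auto simp: S_def PiE_def extensional_def)
  qed
  also have "\<dots> = (\<Sum>k\<in>S K. \<Sum>r\<in>I. milne_term z k * w z k r)"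
    using finS fin by (intro sum.Sigma[symmetric]) auto
  also have "\<dots> = (1 - (\<Prod>s\<in>I. x s / z s) * q ^ K) * (\<Sum>k\<in>S K. milne_term z k)"
    unfolding sum_distrib_left
  proof (intro sum.cong refl)
    fix k assume "k \<in> S K"
    then have "(\<Sum>r\<in>I. w z k r) = 1 - (\<Prod>s\<in>I. x s / z s) * q ^ K"
      unfolding w_sum by (simp add: S_def)
    then show "(\<Sum>r\<in>I. milne_term z k * w z k r)
        = (1 - (\<Prod>s\<in>I. x s / z s) * q ^ K) * milne_term z k"
      by (simp add: sum_distrib_left[symmetric])
  qed
  finally have "(1 - q ^ Suc K) * (\<Sum>k\<in>S (Suc K). milne_term z k)
      = (1 - (\<Prod>s\<in>I. x s / z s) * q ^ K) * (qpoch q (\<Prod>s\<in>I. x s / z s) K / qpoch q q K)"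
    using Suc.IH by (simp add: S_def)
  then show ?case
    using q_pow_neq_1[of K] qpoch_q_nz
    by (simp add: S_def qpoch_Suc field_simps)
qed

text \<open>The diagonal factor \<open>s = r\<close> is \<open>(q^(-N_r))_(k_r)\<close>.\<close>

lemma qpoch_prod_eq_0:
  assumes "r \<in> I" "N r < k r"
  shows "qpoch_prod q I x (qshift q N x) k = 0"
proof -
  have "qpoch q (x r / qshift q N x r) (k r) = 0"
    using assms q_nz x_nz by (auto simp: qpoch_eq_0_iff qshift_def intro!: exI[of _ "N r"])
  then show ?thesis
    unfolding qpoch_prod_def using fin assms(1)
    by (intro prod_zero bexI[of _ r]) auto
qed

text \<open>At \<open>z = q^N x\<close> Milne's theorem gives \<open>(q^(-M))_K / (q)_K\<close> on
  the level \<open>|k| = K\<close>, where \<open>M = |N|\<close>. This is the quotient occurring in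
  \<open>very_well_poised_partial_sum\<close>, which applies with \<open>m = J = M\<close>.\<close>

lemma terminating_sum_eq_0:
  assumes a: "\<And>i. a * q ^ Suc i \<noteq> 1" and N: "sum N I \<noteq> 0"
  shows "(\<Sum>k\<in>(\<Pi>\<^sub>E r\<in>I. {0..N r}). milne_term (qshift q N x) k
            * ((1 - a * q ^ (2 * sum k I)) * qpoch q a (sum k I)
               / qpoch q (a * q ^ Suc (sum N I)) (sum k I) * q ^ (sum N I * sum k I))) = 0"
proof -
  define M where "M = sum N I"
  define c where "c K = (1 - a * q ^ (2 * K)) * qpoch q a K
               / qpoch q (a * q ^ Suc M) K * q ^ (M * K)" for K
  define S where "S K = {k. k \<in> I \<rightarrow>\<^sub>E UNIV \<and> sum k I = K}" for K :: nat
  define T where "T = milne_term (qshift q N x)"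
  have finS: "finite (S K)" for K
    using finite_size_eq by (simp add: S_def)
  \<comment> \<open>Milne's theorem needs full levels \<open>|k| = K\<close>, so the box is enlarged
    by multi-indices at which \<open>milne_term\<close> vanishes.\<close>
  have sub: "(\<Pi>\<^sub>E r\<in>I. {0..N r}) \<subseteq> (\<Union>K\<le>M. S K)"
    by (auto simp: S_def M_def PiE_def Pi_def intro!: sum_mono)
  have T_0: "T k = 0" if "k \<in> (\<Union>K\<le>M. S K) - (\<Pi>\<^sub>E r\<in>I. {0..N r})" for k
  proof -
    from that obtain r where "r \<in> I" "N r < k r"
      by (auto simp: S_def PiE_def Pi_def not_le)
    then show ?thesis by (simp add: T_def milne_term_def qpoch_prod_eq_0)
  qed
  have "(\<Sum>k\<in>(\<Pi>\<^sub>E r\<in>I. {0..N r}). T k * c (sum k I)) = (\<Sum>k\<in>(\<Union>K\<le>M. S K). T k * c (sum k I))"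
    using sub T_0 finS by (intro sum.mono_neutral_left) auto
  also have "\<dots> = (\<Sum>K\<le>M. \<Sum>k\<in>S K. T k * c (sum k I))"
    using finS by (intro sum.UNION_disjoint) (auto simp: S_def)
  also have "\<dots> = (\<Sum>K\<le>M. (\<Sum>k\<in>S K. T k) * c K)"
    by (simp add: S_def sum_distrib_right)
  also have "\<dots> = (\<Sum>K\<le>M. qpoch q (\<Prod>s\<in>I. x s / qshift q N x s) K / qpoch q q K * c K)"
    unfolding T_def S_def milne_fundamental ..
  also have "(\<Prod>s\<in>I. x s / qshift q N x s) = 1 / q ^ M"
  proof -
    have "(\<Prod>s\<in>I. x s / qshift q N x s) = (\<Prod>s\<in>I. 1 / q ^ N s)"
      using x_nz by (intro prod.cong) (auto simp: qshift_def)
    then show ?thesis by (simp add: M_def power_sum prod_dividef)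
  qed
  also have "(\<Sum>K\<le>M. qpoch q (1 / q ^ M) K / qpoch q q K * c K)
      = (1 - a) * (qpoch q (a * q) M * qpoch q (q / q ^ M) M * q ^ (M * M))
             / (qpoch q q M * qpoch q (a * q ^ Suc M) M)"
    using very_well_poised_partial_sum[OF q_nz q_pow_neq_1 a, of M M]
    by (simp add: c_def mult_ac)
  \<comment> \<open>The zero factor is the last one, \<open>1 - q^(1-M) q^(M-1)\<close>; it is
    present because \<open>M > 0\<close>.\<close>
  also have "qpoch q (q / q ^ M) M = 0"
  proof -
    obtain m where "M = Suc m" using N by (cases M) (auto simp: M_def)
    then show ?thesis using q_nz by (auto simp: qpoch_eq_0_iff intro!: exI[of _ m])
  qed
  finally show ?thesis by (simp add: T_def c_def M_def)
qed

end

section \<open>The kernel of the transformation\<close>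

lemma prod_prod_insert:
  fixes h :: "'i \<Rightarrow> 'i \<Rightarrow> 'a::comm_monoid_mult"
  assumes "finite J" "t \<notin> J"
  shows "(\<Prod>r\<in>insert t J. \<Prod>s\<in>insert t J. h r s)
    = h t t * (\<Prod>s\<in>J. h t s * h s t) * (\<Prod>r\<in>J. \<Prod>s\<in>J. h r s)"
proof -
  have row: "(\<Prod>s\<in>insert t J. h r s) = h r t * (\<Prod>s\<in>J. h r s)" for r
    using assms by simp
  show ?thesis
    unfolding row prod.insert[OF assms] prod.distrib by (simp only: mult_ac)
qed

lemma two_times_choose_two: "2 * (m choose 2) + m = m * m" for m :: nat
  by (induction m) (auto simp: numeral_2_eq_2)

section \<open>Reversal of the A_n products and the vanishing kernel sum\<close>

context q_generic
begin

text \<open>The effect of raising \<open>l_t\<close> by one, for \<open>X = q^l x\<close> and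
  \<open>d = k - l\<close>. Only row and column \<open>t\<close> of the double product change, and
  each Pochhammer symbol there gains or loses only factors at its ends.\<close>

lemma qpoch_prod_den_shift:
  fixes X d t
  defines "X' \<equiv> X(t := q * X t)" and "d' \<equiv> d(t := d t - 1)"
  assumes t: "t \<in> I" "d t > 0" and X: "X t \<noteq> 0"
  shows "qpoch_prod q I (\<lambda>r. q * X' r) X' d'
           * ((1 - q ^ d t) * (\<Prod>s\<in>I-{t}. (1 - q * X t / X s) * (1 - q ^ d s * X s / X t)))
         = qpoch_prod q I (\<lambda>r. q * X r) X d * (\<Prod>s\<in>I-{t}. 1 - X s / X t)"
proof -
  define J where "J = I - {t}"
  have J: "I = insert t J" "finite J" "t \<notin> J"
    using t fin by (auto simp: J_def)
  define h where "h r s = qpoch q (q * X r / X s) (d r)" for r s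
  define h' where "h' r s = qpoch q (q * X' r / X' s) (d' r)" for r s
  obtain e where e: "d t = Suc e" using t by (cases "d t") auto
  have tt: "h' t t * (1 - q ^ d t) = h t t"
    using X q_nz by (simp add: h_def h'_def X'_def d'_def e qpoch_Suc)
  have ts: "(h' t s * h' s t) * ((1 - q * X t / X s) * (1 - q ^ d s * X s / X t))
      = (h t s * h s t) * (1 - X s / X t)" if "s \<in> J" for s
  proof -
    have "s \<noteq> t" using that J by auto
    then have 1: "h' t s * (1 - q * X t / X s) = h t s"
      by (simp add: h_def h'_def X'_def d'_def e qpoch_Suc_shift mult_ac)
    have 2: "h' s t * (1 - q ^ d s * X s / X t) = (1 - X s / X t) * h s t"
      using \<open>s \<noteq> t\<close> q_nz X qpoch_Suc[of q "X s / X t" "d s"] qpoch_Suc_shift[of q "X s / X t" "d s"]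
      by (simp add: h_def h'_def X'_def d'_def mult_ac)
    have "(h' t s * h' s t) * ((1 - q * X t / X s) * (1 - q ^ d s * X s / X t))
        = (h' t s * (1 - q * X t / X s)) * (h' s t * (1 - q ^ d s * X s / X t))"
      by (simp only: mult_ac)
    also have "\<dots> = (h t s * h s t) * (1 - X s / X t)"
      unfolding 1 2 by (simp only: mult_ac)
    finally show ?thesis .
  qed
  have JJ: "(\<Prod>r\<in>J. \<Prod>s\<in>J. h' r s) = (\<Prod>r\<in>J. \<Prod>s\<in>J. h r s)"
    using J(3) by (intro prod.cong refl) (auto simp: h_def h'_def X'_def d'_def)
  have "(\<Prod>s\<in>J. h' t s * h' s t) * (\<Prod>s\<in>J. (1 - q * X t / X s) * (1 - q ^ d s * X s / X t))
      = (\<Prod>s\<in>J. h t s * h s t) * (\<Prod>s\<in>J. 1 - X s / X t)"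
    unfolding prod.distrib[symmetric] using ts by (intro prod.cong) auto
  then have "(h' t t * (1 - q ^ d t)) * (\<Prod>r\<in>J. \<Prod>s\<in>J. h' r s)
        * ((\<Prod>s\<in>J. h' t s * h' s t) * (\<Prod>s\<in>J. (1 - q * X t / X s) * (1 - q ^ d s * X s / X t)))
      = h t t * (\<Prod>r\<in>J. \<Prod>s\<in>J. h r s) * ((\<Prod>s\<in>J. h t s * h s t) * (\<Prod>s\<in>J. 1 - X s / X t))"
    unfolding JJ tt by simp
  then have "h' t t * (\<Prod>s\<in>J. h' t s * h' s t) * (\<Prod>r\<in>J. \<Prod>s\<in>J. h' r s)
        * ((1 - q ^ d t) * (\<Prod>s\<in>J. (1 - q * X t / X s) * (1 - q ^ d s * X s / X t)))
      = h t t * (\<Prod>s\<in>J. h t s * h s t) * (\<Prod>r\<in>J. \<Prod>s\<in>J. h r s) * (\<Prod>s\<in>J. 1 - X s / X t)"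
    by (simp only: mult_ac)
  moreover have "(\<Prod>r\<in>I. \<Prod>s\<in>I. g r s)
      = g t t * (\<Prod>s\<in>J. g t s * g s t) * (\<Prod>r\<in>J. \<Prod>s\<in>J. g r s)" for g :: "'i \<Rightarrow> 'i \<Rightarrow> complex"
    unfolding J(1) by (rule prod_prod_insert[OF J(2,3)])
  ultimately show ?thesis
    by (simp add: qpoch_prod_def h_def[symmetric] h'_def[symmetric] J_def[symmetric])
qed

text \<open>Multiple version of
  \<open>(q^(-k))_l (q)_(k-l) q^(kl) = (-1)^l q^binom(l,2) (q)_k\<close>. The induction adds one
  unit to some \<open>l_t\<close>, and the factors gained on the left are compared index by
  index.\<close>

lemma reversal:
  assumes "\<And>r. r \<in> I \<Longrightarrow> l r \<le> k r"
  shows "qpoch_prod q I x (qshift q k x) l * vdm_quot I x (qshift q l x)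
           * qpoch_prod q I (\<lambda>r. q * qshift q l x r) (qshift q l x) (\<lambda>r. k r - l r)
           * q ^ (sum k I * sum l I)
         = (- 1) ^ sum l I * q ^ (sum l I choose 2) * qpoch_prod q I (\<lambda>r. q * x r) x k"
  using assms
proof (induction "sum l I" arbitrary: l)
  case 0
  then have l: "l r = 0" if "r \<in> I" for r using fin that by simp
  have "vdm_quot I x (qshift q l x) = vdm_quot I x x"
    by (rule vdm_quot_cong) (auto simp: qshift_def l)
  moreover have "qpoch_prod q I (\<lambda>r. q * qshift q l x r) (qshift q l x) (\<lambda>r. k r - l r)
      = qpoch_prod q I (\<lambda>r. q * x r) x k"
    by (rule qpoch_prod_cong) (auto simp: qshift_def l)
  ultimately show ?case
    using "0.hyps" vdm_quot_self[OF inj_x] by (simp add: qpoch_prod_0 l numeral_2_eq_2 flip: "0.hyps")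
next
  case (Suc L l')
  have "\<exists>t\<in>I. l' t \<noteq> 0" using Suc.hyps(2) by (metis sum.neutral nat.distinct(1))
  then obtain t where t: "t \<in> I" "l' t \<noteq> 0" by auto
  define l where "l = l'(t := l' t - 1)"
  have l': "l' = l(t := Suc (l t))" using t by (auto simp: l_def)
  have L: "sum l I = L" using Suc.hyps(2) sum_fun_upd_Suc[OF t(1), of l] by (simp add: l')
  have le: "l r \<le> k r" if "r \<in> I" for r
    using Suc.prems[OF that] by (auto simp: l_def split: if_splits)
  have lt: "l t < k t" using Suc.prems[OF t(1)] by (simp add: l')
  define X where "X = qshift q l x"
  define d where "d r = k r - l r" for r
  have X': "qshift q l' x = X(t := q * X t)"
    by (auto simp: qshift_def l' X_def)
  have d': "(\<lambda>r. k r - l' r) = d(t := d t - 1)"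
    by (auto simp: l' d_def)
  have Xnz: "X s \<noteq> 0" if "s \<in> I" for s using qshift_nz[OF that] by (simp add: X_def)
  have Xneq: "X s \<noteq> X t" if "s \<in> I - {t}" for s
    using that t q_generic_eq_iff[of s t] by (auto simp: X_def qshift_def)
  define A where "A = (\<Prod>s\<in>I. 1 - X t / qshift q k x s)"
  define V where "V = (\<Prod>s\<in>I-{t}. (X s - q * X t) / (X s - X t))"
  define B where "B = (\<Prod>s\<in>I-{t}. 1 - X s / X t)"
  define C where "C = (1 - q ^ d t) * (\<Prod>s\<in>I-{t}. (1 - q * X t / X s) * (1 - q ^ d s * X s / X t))"
  have kx: "qshift q k x s = q ^ d s * X s" if "s \<in> I" for s
    using le[OF that] by (simp add: qshift_def X_def d_def power_add[symmetric] mult.assoc[symmetric])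
  \<comment> \<open>Each \<open>s \<noteq> t\<close> balances separately, and \<open>s = t\<close>
    contributes the sign. The powers \<open>q^(d s)\<close> clear the negative powers of
    \<open>q\<close> in \<open>A\<close>.\<close>
  have "A * V * B * q ^ sum d I
     = ((1 - X t / qshift q k x t) * q ^ d t)
       * (\<Prod>s\<in>I-{t}. (1 - X t / qshift q k x s) * ((X s - q * X t) / (X s - X t))
            * (1 - X s / X t) * q ^ d s)"
    unfolding A_def V_def B_def power_sum prod.distrib prod.remove[OF fin t(1)]
    by (simp only: mult_ac)
  also have "\<dots> = - C"
  proof -
    have at_t: "(1 - X t / qshift q k x t) * q ^ d t = - (1 - q ^ d t)"
      using Xnz[OF t(1)] q_nz by (simp add: kx[OF t(1)] field_simps)
    have off_t: "(1 - X t / qshift q k x s) * ((X s - q * X t) / (X s - X t))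
          * (1 - X s / X t) * q ^ d s = (1 - q * X t / X s) * (1 - q ^ d s * X s / X t)"
      if "s \<in> I - {t}" for s
    proof -
      have nz: "X s \<noteq> 0" "X t \<noteq> 0" "X s - X t \<noteq> 0" "q ^ d s \<noteq> 0"
        using that Xnz t(1) Xneq[OF that] q_nz by auto
      have "(1 - X t / (w * X s)) * ((X s - q * X t) / (X s - X t)) * (1 - X s / X t) * w
          = (1 - q * X t / X s) * (1 - w * X s / X t)" if "w \<noteq> 0" for w
        using nz that by (simp add: divide_simps) (simp add: algebra_simps)
      then show ?thesis using kx that nz by simp
    qed
    show ?thesis
      unfolding C_def minus_mult_left at_t
      by (intro arg_cong2[where f = "(*)"] prod.cong refl off_t)
  qed
  finally have AVB: "A * V * B * q ^ sum d I = - C" .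
  have sum_k: "sum k I = sum d I + L"
    unfolding L[symmetric] sum.distrib[symmetric] using le by (intro sum.cong) (auto simp: d_def)
  define P where "P = qpoch_prod q I (\<lambda>r. q * X r) X d"
  define P' where "P' = qpoch_prod q I (\<lambda>r. q * qshift q l' x r) (qshift q l' x) (\<lambda>r. k r - l' r)"
  have P': "P' * C = P * B"
    unfolding P'_def C_def P_def B_def X' d' using t(1) lt Xnz
    by (intro qpoch_prod_den_shift) (auto simp: d_def)
  have "B \<noteq> 0" using Xneq Xnz t(1) fin by (fastforce simp: B_def field_simps)
  have q': "qpoch_prod q I x (qshift q k x) l' = qpoch_prod q I x (qshift q k x) l * A"
    using qpoch_prod_update_Suc[OF fin t(1), of q x "qshift q k x" l]
    by (simp add: l' A_def X_def qshift_def)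
  have v': "vdm_quot I x (qshift q l' x) = vdm_quot I x X * V"
    using vdm_quot_qshift_update[OF t(1)] by (simp add: l' X_def V_def)
  have IH: "qpoch_prod q I x (qshift q k x) l * vdm_quot I x X * P * q ^ (sum k I * L)
      = (- 1) ^ L * q ^ (L choose 2) * qpoch_prod q I (\<lambda>r. q * x r) x k"
    using Suc.hyps(1)[OF L[symmetric] le] by (simp add: L X_def P_def d_def[abs_def])
  have AVP: "A * V * P' * q ^ sum d I = - P"
  proof -
    have "(A * V * P' * q ^ sum d I) * B = P' * (A * V * B * q ^ sum d I)" by (simp add: mult_ac)
    also have "\<dots> = - P * B" using P' by (simp add: AVB)
    finally show ?thesis unfolding mult_right_cancel[OF \<open>B \<noteq> 0\<close>] .
  qed
  \<comment> \<open>Of the additional \<open>q^|k|\<close>, the part \<open>q^|d|\<close> is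
    consumed by \<open>AVP\<close>, while \<open>q^L\<close> turns \<open>binom(L,2)\<close> into
    \<open>binom(L+1,2)\<close>.\<close>
  have qk: "q ^ (sum k I * Suc L) = q ^ sum d I * q ^ L * q ^ (sum k I * L)"
    by (simp add: sum_k power_add[symmetric] algebra_simps)
  have "qpoch_prod q I x (qshift q k x) l' * vdm_quot I x (qshift q l' x) * P'
        * q ^ (sum k I * Suc L)
      = qpoch_prod q I x (qshift q k x) l * vdm_quot I x X * (- P) * q ^ L * q ^ (sum k I * L)"
    unfolding q' v' qk AVP[symmetric] by (simp only: mult_ac)
  also have "\<dots> = - (q ^ L * ((- 1) ^ L * q ^ (L choose 2) * qpoch_prod q I (\<lambda>r. q * x r) x k))"
    unfolding IH[symmetric] by (simp add: mult_ac)
  also have "\<dots> = (- 1) ^ Suc L * q ^ (Suc L choose 2) * qpoch_prod q I (\<lambda>r. q * x r) x k"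
    by (simp add: numeral_2_eq_2 power_add mult_ac)
  finally show ?case
    by (simp add: P'_def Suc.hyps(2)[symmetric])
qed

text \<open>The case \<open>l = k\<close> of \<open>reversal\<close>. Squaring removes the sign and,
  by \<open>2 binom(m,2) = m^2 - m\<close>, leaves a plain power of \<open>q\<close>. In the
  diagonal coefficient all three products occur twice.\<close>

lemma reversal_diagonal:
  "(qpoch_prod q I x (qshift q k x) k * vdm_quot I x (qshift q k x)) ^ 2
     * q ^ (sum k I * sum k I + sum k I) = (qpoch_prod q I (\<lambda>r. q * x r) x k) ^ 2"
proof -
  define m where "m = sum k I"
  define G where "G = qpoch_prod q I x (qshift q k x) k * vdm_quot I x (qshift q k x)"
  define D where "D = qpoch_prod q I (\<lambda>r. q * x r) x k"
  have "G * q ^ (m * m) = (- 1) ^ m * q ^ (m choose 2) * D"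
    using reversal[of k k] by (simp add: qpoch_prod_0 G_def D_def m_def)
  then have "(G * q ^ (m * m)) ^ 2 = (q ^ (m choose 2) * D) ^ 2"
    by (simp add: power_mult_distrib flip: power_mult)
  moreover have "(G * q ^ (m * m)) ^ 2 = G ^ 2 * q ^ (m * m + m) * q ^ (2 * (m choose 2))"
  proof -
    have "m * m * 2 = (m * m + m) + 2 * (m choose 2)"
      using two_times_choose_two[of m] by linarith
    then have "q ^ (m * m * 2) = q ^ (m * m + m) * q ^ (2 * (m choose 2))"
      by (simp only: power_add)
    then show ?thesis by (simp only: power_mult_distrib power_mult[symmetric] mult.assoc)
  qed
  moreover have "(q ^ (m choose 2) * D) ^ 2 = D ^ 2 * q ^ (2 * (m choose 2))"
    by (simp add: power_mult_distrib power_even_eq)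
  ultimately have "G ^ 2 * q ^ (m * m + m) = D ^ 2"
    using q_nz by simp
  then show ?thesis using q_nz by (simp add: G_def D_def m_def)
qed

text \<open>The substitution \<open>k = l + d\<close> with base point \<open>X = q^l x\<close> leads
  to \<open>terminating_sum_eq_0\<close>; strictness at \<open>t\<close> ensures that the new upper
  limit \<open>N - l\<close> is not zero.\<close>

lemma kernel_sum_eq_0:
  assumes a: "\<And>i. a * q ^ Suc i \<noteq> 1"
    and le: "\<And>r. r \<in> I \<Longrightarrow> l r \<le> N r" and lt: "t \<in> I" "l t < N t"
  shows "(\<Sum>k\<in>(\<Pi>\<^sub>E r\<in>I. {l r..N r}). milne_term (qshift q N x) k * q ^ (sum N I * sum k I)
            * qpoch_prod q I x (qshift q k x) l
            * ((1 - a * q ^ (2 * sum k I)) * qpoch q a (sum k I + sum l I)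
               / qpoch q (a * q ^ Suc (sum N I)) (sum k I))) = 0"
proof -
  define X where "X = qshift q l x"
  interpret L: q_generic q I X
    unfolding X_def by (rule q_generic_qshift)
  define M where "M r = N r - l r" for r
  have sumN: "sum N I = sum M I + sum l I"
    unfolding sum.distrib[symmetric] using le by (intro sum.cong) (auto simp: M_def)
  have M0: "sum M I \<noteq> 0"
    using lt fin by (auto simp: M_def intro!: bexI[of _ t])
  have NX: "qshift q N x r = qshift q M X r" if "r \<in> I" for r
    using le[OF that] by (simp add: qshift_def X_def M_def mult.assoc[symmetric] power_add[symmetric])
  \<comment> \<open>\<open>c\<close> collects the factors free of \<open>d\<close>. The parameter
    \<open>a' = a q^(2|l|)\<close> comes from \<open>(a)_(|k|+|l|) = (a)_(2|l|) (a')_|d|\<close> and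
    also fits \<open>1 - a q^(2|k|)\<close>.\<close>
  define c where "c = (- 1) ^ sum l I * q ^ (sum l I choose 2) * qpoch_prod q I x (qshift q N x) l
      * qpoch q a (2 * sum l I) / qpoch q (a * q ^ Suc (sum N I)) (sum l I) * q ^ (sum M I * sum l I)"
  define a' where "a' = a * q ^ (2 * sum l I)"
  have a': "a' * q ^ Suc i \<noteq> 1" for i
    using a[of "2 * sum l I + i"] by (simp add: a'_def power_add mult_ac)
  have "(\<Sum>k\<in>(\<Pi>\<^sub>E r\<in>I. {l r..N r}). milne_term (qshift q N x) k * q ^ (sum N I * sum k I)
            * qpoch_prod q I x (qshift q k x) l
            * ((1 - a * q ^ (2 * sum k I)) * qpoch q a (sum k I + sum l I)
               / qpoch q (a * q ^ Suc (sum N I)) (sum k I)))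
     = (\<Sum>d\<in>(\<Pi>\<^sub>E r\<in>I. {0..M r}). c * (L.milne_term (qshift q M X) d
            * ((1 - a' * q ^ (2 * sum d I)) * qpoch q a' (sum d I)
               / qpoch q (a' * q ^ Suc (sum M I)) (sum d I) * q ^ (sum M I * sum d I))))"
  proof (intro sum.reindex_bij_witness
      [where j = "\<lambda>k. \<lambda>r\<in>I. k r - l r" and i = "\<lambda>d. \<lambda>r\<in>I. d r + l r"])
    fix k assume k: "k \<in> (\<Pi>\<^sub>E r\<in>I. {l r..N r})"
    then have lk: "l r \<le> k r" if "r \<in> I" for r
      using that by (auto simp: PiE_def Pi_def)
    show "(\<lambda>r\<in>I. (\<lambda>r\<in>I. k r - l r) r + l r) = k"
      using k lk by (auto simp: fun_eq_iff PiE_def extensional_def)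
    show "(\<lambda>r\<in>I. k r - l r) \<in> (\<Pi>\<^sub>E r\<in>I. {0..M r})"
      using k by (auto simp: M_def PiE_def Pi_def intro: diff_le_mono)
    define d where "d = (\<lambda>r\<in>I. k r - l r)"
    have sumk: "sum k I = sum d I + sum l I"
      unfolding sum.distrib[symmetric] using lk by (intro sum.cong) (auto simp: d_def)
    have kX: "qshift q k x r = qshift q d X r" if "r \<in> I" for r
      using lk[OF that] that
      by (simp add: qshift_def X_def d_def mult.assoc[symmetric] power_add[symmetric])
    define v where "v = vdm_quot I X (qshift q d X)"
    define P where "P = qpoch_prod q I (\<lambda>r. q * X r) X d"
    define D where "D = qpoch_prod q I (\<lambda>r. q * x r) x k"
    have nz: "D \<noteq> 0" "P \<noteq> 0"
      using qpoch_prod_den_nz L.qpoch_prod_den_nz by (simp_all add: D_def P_def)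
    \<comment> \<open>\<open>Q\<close> stands for \<open>(q^(-k_s) x_r / x_s)_(l_r)\<close>. The
      assumption is supplied by \<open>reversal\<close>, which exchanges the denominator
      \<open>D\<close> at \<open>x\<close> for \<open>P\<close> at \<open>X\<close>.\<close>
    have kernel_algebra: "\<sigma> * \<rho> * g / h * u * (v * \<pi> / P * (A * g' / h' * u'))
        = w * v * (\<rho> * \<pi>) / D * (e * u * u') * Q * (A * (g * g') / (h * h'))"
      if "Q * (w * P * e) = \<sigma> * D" for \<sigma> \<rho> g h u \<pi> A g' h' u' w e Q
    proof -
      have "\<sigma> = Q * (w * P * e) / D" using that nz by (simp add: field_simps)
      then show ?thesis using nz by simp
    qed
    have "vdm_quot I x (qshift q k x) = vdm_quot I x X * v"
      unfolding v_def vdm_quot_trans[OF fin L.inj_x] using kX by (intro vdm_quot_cong) auto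
    moreover have "qpoch_prod q I x (qshift q N x) k
        = qpoch_prod q I x (qshift q N x) l * qpoch_prod q I X (qshift q M X) d"
    proof -
      have "qpoch_prod q I x (qshift q N x) k = qpoch_prod q I x (qshift q N x) (\<lambda>r. l r + d r)"
        using lk by (intro qpoch_prod_cong) (auto simp: d_def)
      also have "\<dots> = qpoch_prod q I x (qshift q N x) l * qpoch_prod q I X (qshift q N x) d"
        unfolding qpoch_prod_add X_def ..
      also have "qpoch_prod q I X (qshift q N x) d = qpoch_prod q I X (qshift q M X) d"
        using NX by (intro qpoch_prod_cong) auto
      finally show ?thesis .
    qed
    moreover have "qpoch_prod q I x (qshift q k x) l * (vdm_quot I x X * P * q ^ (sum k I * sum l I))
        = (- 1) ^ sum l I * q ^ (sum l I choose 2) * D"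
    proof -
      have "qpoch_prod q I (\<lambda>r. q * X r) X (\<lambda>r. k r - l r) = P"
        unfolding P_def by (intro qpoch_prod_cong) (auto simp: d_def)
      then show ?thesis
        using reversal[of l k, OF lk] by (simp add: X_def D_def mult_ac)
    qed
    moreover have "qpoch q a (sum k I + sum l I) = qpoch q a (2 * sum l I) * qpoch q a' (sum d I)"
      unfolding a'_def qpoch_add[symmetric] sumk by (simp add: mult_2 add_ac)
    moreover have "qpoch q (a * q ^ Suc (sum N I)) (sum k I)
        = qpoch q (a * q ^ Suc (sum N I)) (sum l I) * qpoch q (a' * q ^ Suc (sum M I)) (sum d I)"
      unfolding sumk add.commute[of "sum d I"] qpoch_add
      by (simp add: a'_def sumN power_add mult_2 mult_2_right mult_ac)
    moreover have "a * q ^ (2 * sum k I) = a' * q ^ (2 * sum d I)"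
      by (simp add: a'_def sumk power_add algebra_simps)
    \<comment> \<open>The factor \<open>q^(|k||l|)\<close> is the one that \<open>reversal\<close>
      consumes.\<close>
    moreover have "q ^ (sum N I * sum k I)
        = q ^ (sum k I * sum l I) * q ^ (sum M I * sum l I) * q ^ (sum M I * sum d I)"
      by (simp add: sumN sumk power_add[symmetric] algebra_simps)
    ultimately show "c * (L.milne_term (qshift q M X) (\<lambda>r\<in>I. k r - l r)
            * ((1 - a' * q ^ (2 * sum (\<lambda>r\<in>I. k r - l r) I)) * qpoch q a' (sum (\<lambda>r\<in>I. k r - l r) I)
               / qpoch q (a' * q ^ Suc (sum M I)) (sum (\<lambda>r\<in>I. k r - l r) I)
               * q ^ (sum M I * sum (\<lambda>r\<in>I. k r - l r) I)))
       = milne_term (qshift q N x) k * q ^ (sum N I * sum k I)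
            * qpoch_prod q I x (qshift q k x) l
            * ((1 - a * q ^ (2 * sum k I)) * qpoch q a (sum k I + sum l I)
               / qpoch q (a * q ^ Suc (sum N I)) (sum k I))"
      unfolding d_def[symmetric] c_def milne_term_def L.milne_term_def D_def[symmetric]
        P_def[symmetric] v_def[symmetric]
      using kernel_algebra by simp
  next
    fix d assume d: "d \<in> (\<Pi>\<^sub>E r\<in>I. {0..M r})"
    then show "(\<lambda>r\<in>I. (\<lambda>r\<in>I. d r + l r) r - l r) = d"
      by (auto simp: fun_eq_iff PiE_def extensional_def)
    have "d r + l r \<le> N r" if "r \<in> I" for r
      using d that le[OF that] by (force simp: M_def PiE_def Pi_def)
    then show "(\<lambda>r\<in>I. d r + l r) \<in> (\<Pi>\<^sub>E r\<in>I. {l r..N r})"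
      by auto
  qed
  also have "\<dots> = 0"
    unfolding sum_distrib_left[symmetric] L.terminating_sum_eq_0[OF a' M0] by simp
  finally show ?thesis .
qed

end

section \<open>Interchange of the sums and the surviving coefficient\<close>

lemma sum_triangular_swap:
  fixes I :: "'i set" and N :: "'i \<Rightarrow> nat" and f :: "('i \<Rightarrow> nat) \<Rightarrow> ('i \<Rightarrow> nat) \<Rightarrow> ('i \<Rightarrow> nat) \<Rightarrow> 'a::comm_monoid_add"
  assumes "finite I"
  shows "(\<Sum>k\<in>(\<Pi>\<^sub>E r\<in>I. {0..N r}). \<Sum>j\<in>(\<Pi>\<^sub>E r\<in>I. {0..k r}). \<Sum>m\<in>(\<Pi>\<^sub>E r\<in>I. {0..k r - j r}). f k j m)
       = (\<Sum>j\<in>(\<Pi>\<^sub>E r\<in>I. {0..N r}). \<Sum>m\<in>(\<Pi>\<^sub>E r\<in>I. {0..N r - j r}).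
            \<Sum>k\<in>(\<Pi>\<^sub>E r\<in>I. {j r + m r..N r}). f k j m)"
    (is "?L = ?R")
proof -
  have fin: "finite (\<Pi>\<^sub>E r\<in>I. {u r..v r})" for u v :: "'i \<Rightarrow> nat"
    using assms by (intro finite_PiE) auto
  define A where "A = Sigma (\<Pi>\<^sub>E r\<in>I. {0..N r}) (\<lambda>k. Sigma (\<Pi>\<^sub>E r\<in>I. {0..k r}) (\<lambda>j. \<Pi>\<^sub>E r\<in>I. {0..k r - j r}))"
  define B where "B = Sigma (\<Pi>\<^sub>E r\<in>I. {0..N r})
      (\<lambda>j. Sigma (\<Pi>\<^sub>E r\<in>I. {0..N r - j r}) (\<lambda>m. \<Pi>\<^sub>E r\<in>I. {j r + m r..N r}))"
  have "?L = (\<Sum>(k, j, m)\<in>A. f k j m)"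
    unfolding A_def using fin by (simp add: sum.Sigma finite_SigmaI)
  also have "\<dots> = (\<Sum>(j, m, k)\<in>B. f k j m)"
  proof (intro sum.reindex_bij_witness
      [where i = "\<lambda>(j, m, k). (k, j, m)" and j = "\<lambda>(k, j, m). (j, m, k)"])
    fix p assume "p \<in> A"
    then obtain k j m where p: "p = (k, j, m)" and ext: "k \<in> extensional I" "j \<in> extensional I" "m \<in> extensional I"
      and le: "\<And>r. r \<in> I \<Longrightarrow> k r \<le> N r \<and> j r \<le> k r \<and> m r \<le> k r - j r"
      by (auto simp: A_def PiE_def Pi_def)
    have "j r \<le> N r \<and> m r \<le> N r - j r \<and> j r + m r \<le> k r" if "r \<in> I" for r
      using le[OF that] by linarith
    then show "(case p of (k, j, m) \<Rightarrow> (j, m, k)) \<in> B"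
      using ext le by (simp add: p B_def PiE_def Pi_def)
  next
    fix p assume "p \<in> B"
    then obtain k j m where p: "p = (j, m, k)" and ext: "k \<in> extensional I" "j \<in> extensional I" "m \<in> extensional I"
      and le: "\<And>r. r \<in> I \<Longrightarrow> k r \<le> N r \<and> j r + m r \<le> k r"
      by (auto simp: B_def PiE_def Pi_def)
    have "j r \<le> k r \<and> m r \<le> k r - j r" if "r \<in> I" for r
      using le[OF that] by linarith
    then show "(case p of (j, m, k) \<Rightarrow> (k, j, m)) \<in> A"
      using ext le by (simp add: p A_def PiE_def Pi_def)
  qed auto
  also have "\<dots> = ?R"
    unfolding B_def using fin by (simp add: sum.Sigma finite_SigmaI)
  finally show ?thesis .
qed

context q_generic
begin

text \<open>After the sums over \<open>k\<close>, \<open>j\<close> and \<open>m\<close> are interchanged, the coefficient of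
  \<open>\<beta>(j) K(q\<^sup>j\<^sup>+\<^sup>m)\<close> splits into a factor depending on \<open>k\<close> and \<open>l = j + m\<close> and one free of \<open>k\<close>.\<close>

definition outer_coeff :: "complex \<Rightarrow> ('i \<Rightarrow> nat) \<Rightarrow> ('i \<Rightarrow> nat) \<Rightarrow> ('i \<Rightarrow> nat) \<Rightarrow> complex" where
  "outer_coeff a N k l = milne_term (qshift q N x) k * q ^ (sum N I * sum k I)
            * qpoch_prod q I x (qshift q k x) l
            * ((1 - a * q ^ (2 * sum k I)) * qpoch q a (sum k I + sum l I)
               / qpoch q (a * q ^ Suc (sum N I)) (sum k I))"

definition inner_coeff :: "complex \<Rightarrow> complex \<Rightarrow> ('i \<Rightarrow> nat) \<Rightarrow> ('i \<Rightarrow> nat) \<Rightarrow> complex" where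
  "inner_coeff a b j m =
     vdm_quot I x (qshift q (\<lambda>r. j r + m r) x) * q ^ (sum j I + sum m I)
     * ((- 1) ^ sum j I * q ^ (sum j I choose 2))
     * (qpoch q (b * q) (sum j I + sum m I) * (1 - b * q ^ (2 * sum j I)))
     / (qpoch q b (Suc (2 * sum j I + sum m I)) * ((1 - a) * qpoch q (a * q) (sum j I + sum m I))
        * qpoch_prod q I (\<lambda>r. q * qshift q j x r) (qshift q j x) m)"

lemma outer_coeff_sum:
  assumes a: "\<And>i. a * q ^ Suc i \<noteq> 1" and le: "\<And>r. r \<in> I \<Longrightarrow> l r \<le> N r"
    and N: "N \<in> extensional I"
  shows "(\<Sum>k\<in>(\<Pi>\<^sub>E r\<in>I. {l r..N r}). outer_coeff a N k l)
    = (if \<forall>r\<in>I. l r = N r then outer_coeff a N N N else 0)"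
proof (cases "\<forall>r\<in>I. l r = N r")
  case True
  have "(\<Pi>\<^sub>E r\<in>I. {l r..N r}) = (\<Pi>\<^sub>E r\<in>I. {N r})"
    using True by (intro PiE_cong) simp
  also have "\<dots> = {N}"
    by (rule PiE_singleton[OF N])
  finally have "(\<Sum>k\<in>(\<Pi>\<^sub>E r\<in>I. {l r..N r}). outer_coeff a N k l) = outer_coeff a N N l"
    by simp
  moreover have "qpoch_prod q I x (qshift q N x) l = qpoch_prod q I x (qshift q N x) N"
    using True by (intro qpoch_prod_cong) auto
  moreover have "sum l I = sum N I" using True by simp
  ultimately show ?thesis using True by (simp add: outer_coeff_def)
next
  case False
  then obtain t where t: "t \<in> I" "l t < N t" using le by (metis order_le_less)
  show ?thesis
    unfolding if_not_P[OF False] outer_coeff_def by (rule kernel_sum_eq_0[where l = l and N = N and t = t, OF a le t])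
qed

text \<open>Here \<open>a\<close> drops out: with \<open>n = |N|\<close>, the product
  \<open>(1 - a q^(2n)) (a)_(2n)\<close> splits into exactly the three \<open>a\<close>-factors of
  the denominators. \<open>reversal\<close> then removes \<open>P\<close>, and
  \<open>reversal_diagonal\<close> the squares that remain.\<close>

lemma diagonal_coeff:
  assumes a: "a \<noteq> 1" "\<And>i. a * q ^ Suc i \<noteq> 1" and b: "\<And>i. b * q ^ i \<noteq> 1"
    and le: "\<And>r. r \<in> I \<Longrightarrow> j r \<le> N r"
  shows "inner_coeff a b j (\<lambda>r. N r - j r) * outer_coeff a N N N
    = vdm_quot I x (qshift q j x) * (qpoch_prod q I x (qshift q N x) j * q ^ (sum N I * sum j I))
      * ((1 - b * q ^ (2 * sum j I)) / ((1 - b) * qpoch q (b * q ^ Suc (sum N I)) (sum j I)))"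
proof -
  define P where "P = qpoch_prod q I (\<lambda>r. q * qshift q j x r) (qshift q j x) (\<lambda>r. N r - j r)"
  define D where "D = qpoch_prod q I (\<lambda>r. q * x r) x N"
  define G where "G = qpoch_prod q I x (qshift q N x) N"
  define V where "V = vdm_quot I x (qshift q N x)"
  define n where "n = sum N I"
  define p where "p = sum j I"
  have P: "P \<noteq> 0"
  proof -
    interpret J: q_generic q I "qshift q j x" by (rule q_generic_qshift)
    show ?thesis unfolding P_def by (rule J.qpoch_prod_den_nz)
  qed
  have D: "D \<noteq> 0" unfolding D_def by (rule qpoch_prod_den_nz)
  have sums: "p + (\<Sum>r\<in>I. N r - j r) = n"
    unfolding p_def n_def sum.distrib[symmetric] using le by (intro sum.cong) auto
  have V: "vdm_quot I x (qshift q (\<lambda>r. j r + (N r - j r)) x) = V"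
    unfolding V_def using le by (intro vdm_quot_cong) (auto simp: qshift_def)
  have GV: "(G * V)\<^sup>2 * (q ^ (n * n) * q ^ n) = D\<^sup>2"
    using reversal_diagonal[of N] by (simp add: G_def V_def D_def n_def power_add)
  \<comment> \<open>Eliminating the sign by \<open>reversal\<close> brings in the numerator
    \<open>(q^(-N_s) x_r / x_s)_(j_r)\<close> of the left-hand side.\<close>
  have rev: "(- 1) ^ p * q ^ (p choose 2)
      = qpoch_prod q I x (qshift q N x) j * vdm_quot I x (qshift q j x) * P * q ^ (n * p) / D"
    using reversal[OF le] D by (simp add: P_def D_def n_def p_def)
  have qa: "(1 - a * q ^ (2 * n)) * qpoch q a (n + n)
      = (1 - a) * qpoch q (a * q) n * qpoch q (a * q ^ Suc n) n"
  proof -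
    have "(1 - a * q ^ (2 * n)) * qpoch q a (n + n) = qpoch q a (Suc (n + n))"
      by (simp add: qpoch_Suc mult_2)
    also have "\<dots> = (1 - a) * qpoch q (a * q) (n + n)"
      by (rule qpoch_Suc_shift)
    finally show ?thesis by (simp add: qpoch_add mult_ac)
  qed
  have qb: "qpoch q b (Suc (p + n)) = (1 - b) * qpoch q (b * q) n * qpoch q (b * q ^ Suc n) p"
    unfolding qpoch_Suc_shift add.commute[of p] by (simp add: qpoch_add mult_ac)
  have a_nz: "1 - a \<noteq> 0" "qpoch q (a * q) n \<noteq> 0" "qpoch q (a * q ^ Suc n) n \<noteq> 0"
    using a(1) a(2) a(2)[of "n + _"] by (auto simp: qpoch_eq_0_iff power_add mult_ac)
  have b_nz: "1 - b \<noteq> 0" "qpoch q (b * q) n \<noteq> 0" "qpoch q (b * q ^ Suc n) p \<noteq> 0"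
    using b[of 0] b[of "Suc _"] b[of "Suc n + _"] by (auto simp: qpoch_eq_0_iff power_add mult_ac)
  have sums': "2 * p + (\<Sum>r\<in>I. N r - j r) = p + n" using sums by simp
  have inner: "inner_coeff a b j (\<lambda>r. N r - j r)
      = V * q ^ n * ((- 1) ^ p * q ^ (p choose 2)) * (qpoch q (b * q) n * (1 - b * q ^ (2 * p)))
        / ((1 - b) * qpoch q (b * q) n * qpoch q (b * q ^ Suc n) p * ((1 - a) * qpoch q (a * q) n) * P)"
    unfolding inner_coeff_def p_def[symmetric] sums sums' V P_def[symmetric] qb[symmetric] by simp
  have outer: "outer_coeff a N N N = V * G / D * q ^ (n * n) * G * ((1 - a) * qpoch q (a * q) n)"
    unfolding outer_coeff_def milne_term_def G_def[symmetric] V_def[symmetric] D_def[symmetric]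
      n_def[symmetric] qa using a_nz by simp
  have alg: "V * Q * (Q1 * v * P * q' / D) * (B * b2) / (b1 * B * B' * (a1 * A) * P)
       * (V * G / D * Q2 * G * (a1 * A)) = v * (Q1 * q') * (b2 / (b1 * B'))"
    if "(G * V)\<^sup>2 * (Q2 * Q) = D\<^sup>2" "B \<noteq> 0" "a1 \<noteq> 0" "A \<noteq> 0" for Q Q1 v q' B b2 b1 B' a1 A Q2
  proof -
    have "V * Q * (Q1 * v * P * q' / D) * (B * b2) / (b1 * B * B' * (a1 * A) * P)
       * (V * G / D * Q2 * G * (a1 * A))
       = ((G * V)\<^sup>2 * (Q2 * Q)) / D\<^sup>2 * (v * (Q1 * q') * (b2 / (b1 * B')))"
    proof -
      have "(B * b2) / (b1 * B * B' * (a1 * A) * P) = b2 / (b1 * B') / (a1 * A * P)"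
        using that(2) by simp
      then show ?thesis
        unfolding times_divide_eq_right[symmetric] using that(2-) P D
        by (simp add: power2_eq_square) (simp only: mult_ac)
    qed
    then show ?thesis using D that(1) by simp
  qed
  show ?thesis
    unfolding inner outer rev alg[OF GV b_nz(2) a_nz(1,2)] by (simp add: n_def p_def)
qed

text \<open>With the sum over \<open>k\<close> innermost, each \<open>j\<close> leaves only
  \<open>m = N - j\<close>. Hence \<kappa> is evaluated at \<open>N\<close> alone, which is the
  factor \<open>K(y)\<close> in front of the left-hand side.\<close>

lemma triangular_sum:
  assumes a: "a \<noteq> 1" "\<And>i. a * q ^ Suc i \<noteq> 1" and b: "\<And>i. b * q ^ i \<noteq> 1"
    and N: "N \<in> extensional I"
  shows "(\<Sum>k\<in>(\<Pi>\<^sub>E r\<in>I. {0..N r}). \<Sum>j\<in>(\<Pi>\<^sub>E r\<in>I. {0..k r}). \<Sum>m\<in>(\<Pi>\<^sub>E r\<in>I. {0..k r - j r}).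
            \<kappa> (\<lambda>r\<in>I. m r + j r) * \<beta> j * (inner_coeff a b j m * outer_coeff a N k (\<lambda>r. j r + m r)))
     = (\<Sum>j\<in>(\<Pi>\<^sub>E r\<in>I. {0..N r}). \<kappa> N * \<beta> j *
       (vdm_quot I x (qshift q j x) * (qpoch_prod q I x (qshift q N x) j * q ^ (sum N I * sum j I))
      * ((1 - b * q ^ (2 * sum j I)) / ((1 - b) * qpoch q (b * q ^ Suc (sum N I)) (sum j I)))))"
  (is "?L = ?R")
proof -
  have "?L = (\<Sum>j\<in>(\<Pi>\<^sub>E r\<in>I. {0..N r}). \<Sum>m\<in>(\<Pi>\<^sub>E r\<in>I. {0..N r - j r}).
      \<kappa> (\<lambda>r\<in>I. m r + j r) * \<beta> j * (inner_coeff a b j m *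
         (\<Sum>k\<in>(\<Pi>\<^sub>E r\<in>I. {j r + m r..N r}). outer_coeff a N k (\<lambda>r. j r + m r))))"
    unfolding sum_triangular_swap[OF fin] sum_distrib_left ..
  also have "\<dots> = ?R"
  proof (intro sum.cong refl)
    fix j assume j: "j \<in> (\<Pi>\<^sub>E r\<in>I. {0..N r})"
    then have le: "j r \<le> N r" if "r \<in> I" for r using that by (auto simp: PiE_def Pi_def)
    \<comment> \<open>\<open>N - j\<close> in extensional form, so that it belongs to the range of
      \<open>m\<close>.\<close>
    define d where "d = (\<lambda>r\<in>I. N r - j r)"
    define g where "g m = \<kappa> (\<lambda>r\<in>I. m r + j r) * \<beta> j * (inner_coeff a b j m * outer_coeff a N N N)" for m
    have "(\<Sum>m\<in>(\<Pi>\<^sub>E r\<in>I. {0..N r - j r}).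
      \<kappa> (\<lambda>r\<in>I. m r + j r) * \<beta> j * (inner_coeff a b j m *
         (\<Sum>k\<in>(\<Pi>\<^sub>E r\<in>I. {j r + m r..N r}). outer_coeff a N k (\<lambda>r. j r + m r))))
      = (\<Sum>m\<in>(\<Pi>\<^sub>E r\<in>I. {0..N r - j r}). if m = d then g d else 0)"
    proof (intro sum.cong refl)
      fix m assume m: "m \<in> (\<Pi>\<^sub>E r\<in>I. {0..N r - j r})"
      then have mle: "j r + m r \<le> N r" if "r \<in> I" for r
        using that le[OF that] by (force simp: PiE_def Pi_def)
      have "m = d \<longleftrightarrow> (\<forall>r\<in>I. m r = N r - j r)"
        using m by (auto simp: d_def PiE_def extensional_def fun_eq_iff)
      also have "\<dots> \<longleftrightarrow> (\<forall>r\<in>I. j r + m r = N r)"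
        using mle le by (intro ball_cong refl) force
      finally have "m = d \<longleftrightarrow> (\<forall>r\<in>I. j r + m r = N r)" .
      moreover have "(\<Sum>k\<in>(\<Pi>\<^sub>E r\<in>I. {j r + m r..N r}). outer_coeff a N k (\<lambda>r. j r + m r))
          = (if \<forall>r\<in>I. j r + m r = N r then outer_coeff a N N N else 0)"
        by (rule outer_coeff_sum[OF a(2) mle N])
      ultimately show "\<kappa> (\<lambda>r\<in>I. m r + j r) * \<beta> j * (inner_coeff a b j m *
         (\<Sum>k\<in>(\<Pi>\<^sub>E r\<in>I. {j r + m r..N r}). outer_coeff a N k (\<lambda>r. j r + m r)))
         = (if m = d then g d else 0)"
        by (cases "m = d") (auto simp: g_def)
    qed
    also have "\<dots> = g d"
      using fin by (subst sum.delta) (auto simp: d_def finite_PiE)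
    also have "(\<lambda>r\<in>I. d r + j r) = N"
      using N le by (auto simp: d_def fun_eq_iff extensional_def)
    then have "g d = \<kappa> N * \<beta> j * (inner_coeff a b j (\<lambda>r. N r - j r) * outer_coeff a N N N)"
    proof -
      have "inner_coeff a b j d = inner_coeff a b j (\<lambda>r. N r - j r)"
      proof -
        have "vdm_quot I x (qshift q (\<lambda>r. j r + d r) x)
            = vdm_quot I x (qshift q (\<lambda>r. j r + (N r - j r)) x)"
          by (rule vdm_quot_cong) (auto simp: qshift_def d_def)
        moreover have "qpoch_prod q I X Z d = qpoch_prod q I X Z (\<lambda>r. N r - j r)" for X Z
          by (rule qpoch_prod_cong) (auto simp: d_def)
        moreover have "sum d I = (\<Sum>r\<in>I. N r - j r)"
          by (rule sum.cong) (auto simp: d_def)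
        ultimately show ?thesis by (simp only: inner_coeff_def)
      qed
      then show ?thesis using \<open>(\<lambda>r\<in>I. d r + j r) = N\<close> by (simp only: g_def)
    qed
    also note diagonal_coeff[OF a b le]
    finally show "(\<Sum>m\<in>(\<Pi>\<^sub>E r\<in>I. {0..N r - j r}).
      \<kappa> (\<lambda>r\<in>I. m r + j r) * \<beta> j * (inner_coeff a b j m *
         (\<Sum>k\<in>(\<Pi>\<^sub>E r\<in>I. {j r + m r..N r}). outer_coeff a N k (\<lambda>r. j r + m r))))
      = \<kappa> N * \<beta> j *
       (vdm_quot I x (qshift q j x) * (qpoch_prod q I x (qshift q N x) j * q ^ (sum N I * sum j I))
      * ((1 - b * q ^ (2 * sum j I)) / ((1 - b) * qpoch q (b * q ^ Suc (sum N I)) (sum j I))))" .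
  qed
  finally show ?thesis .
qed

end

section \<open>Analytic continuation from the points \<open>q ^ N\<close>\<close>

text \<open>Expand around a point of the line through \<open>z\<close> in direction
  \<open>r\<close>. On this line every monomial that involves another coordinate vanishes, which
  leaves a power series in one variable.\<close>

lemma multi_analytic_on_imp_holomorphic_on:
  assumes f: "multi_analytic_on n f (polydisc n (\<lambda>_. 0) R)" and r: "r \<in> {1..n}"
    and z: "z \<in> polydisc n (\<lambda>_. 0) R"
  shows "(\<lambda>t. f (z(r := t))) holomorphic_on ball 0 R"
proof -
  have "(\<lambda>t. f (z(r := t))) field_differentiable at u" if u: "u \<in> ball 0 R" for u
  proof -
    define w where "w = z(r := u)"
    have "w \<in> polydisc n (\<lambda>_. 0) R"
      using z u r by (auto simp: w_def polydisc_def PiE_def extensional_def)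
    then obtain \<rho> c where \<rho>: "\<rho> > 0" and c: "\<And>v. v \<in> polydisc n w \<rho> \<Longrightarrow>
        ((\<lambda>\<alpha>. c \<alpha> * (\<Prod>s=1..n. (v s - w s) ^ \<alpha> s)) has_sum f v) (multi_indices n)"
      using f unfolding multi_analytic_on_def by blast
    define e where "e i = (\<lambda>s\<in>{1..n}. if s = r then i else 0::nat)" for i
    have inj: "inj e"
    proof (rule injI)
      fix i j assume "e i = e j"
      then have "e i r = e j r" by simp
      then show "i = j" using r by (simp add: e_def)
    qed
    have e_prod: "(\<Prod>s=1..n. ((z(r := t)) s - w s) ^ e i s) = (t - u) ^ i" for t i
    proof -
      have "(\<Prod>s=1..n. ((z(r := t)) s - w s) ^ e i s) = (\<Prod>s=1..n. if s = r then (t - u) ^ i else 1)"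
        by (intro prod.cong) (auto simp: e_def w_def)
      then show ?thesis using r by simp
    qed
    have "(\<lambda>i. c (e i) * (t - u) ^ i) sums f (z(r := t))" if t: "t \<in> ball u \<rho>" for t
    proof -
      let ?g = "\<lambda>\<alpha>. c \<alpha> * (\<Prod>s=1..n. ((z(r := t)) s - w s) ^ \<alpha> s)"
      have "z(r := t) \<in> polydisc n w \<rho>"
        using z t r \<rho> by (auto simp: w_def polydisc_def PiE_def extensional_def)
      then have "(?g has_sum f (z(r := t))) (multi_indices n)"
        by (rule c)
      moreover have "?g \<alpha> = 0" if \<alpha>: "\<alpha> \<in> multi_indices n - range e" for \<alpha>
      proof -
        have "\<exists>s\<in>{1..n}. s \<noteq> r \<and> \<alpha> s \<noteq> 0"
        proof (rule ccontr)
          assume "\<not> ?thesis"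
          then have "\<alpha> = e (\<alpha> r)"
            using \<alpha> by (auto simp: e_def multi_indices_def PiE_def extensional_def fun_eq_iff)
          then show False using \<alpha> by auto
        qed
        then obtain s where "s \<in> {1..n}" "s \<noteq> r" "\<alpha> s \<noteq> 0" by blast
        then have "(\<Prod>s=1..n. ((z(r := t)) s - w s) ^ \<alpha> s) = 0"
          by (intro prod_zero bexI[of _ s]) (auto simp: w_def)
        then show ?thesis by simp
      qed
      ultimately have "(?g has_sum f (z(r := t))) (range e)"
        by (subst has_sum_cong_neutral[where T = "multi_indices n"])
           (auto simp: e_def multi_indices_def)
      then have "((\<lambda>i. c (e i) * (t - u) ^ i) has_sum f (z(r := t))) UNIV"
        by (simp only: has_sum_reindex[OF inj] o_def e_prod)
      then show ?thesis by (rule has_sum_imp_sums)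
    qed
    then have "(\<lambda>t. f (z(r := t))) holomorphic_on ball u \<rho>"
      by (rule power_series_holomorphic)
    then show ?thesis
      using \<rho> by (auto simp: holomorphic_on_def dest!: bspec[of _ _ u] simp: at_within_open[of u "ball u \<rho>"])
  qed
  then show ?thesis
    by (auto simp: holomorphic_on_def intro: field_differentiable_at_within)
qed

text \<open>The one-variable identity theorem frees the coordinates one after the other.\<close>

lemma multi_analytic_identity:
  assumes f: "multi_analytic_on n f (polydisc n (\<lambda>_. 0) R)"
    and g: "multi_analytic_on n g (polydisc n (\<lambda>_. 0) R)"
    and R: "R > 0" and q: "q \<noteq> 0" "norm q < 1"
    and eq: "\<And>N. f (\<lambda>r\<in>{1..n}. q ^ N r) = g (\<lambda>r\<in>{1..n}. q ^ N r)"
    and z: "z \<in> polydisc n (\<lambda>_. 0) R"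
  shows "f z = g z"
proof -
  \<comment> \<open>The first \<open>d\<close> coordinates are free, the others are powers of
    \<open>q\<close>; \<open>d = 0\<close> is the assumption \<open>eq\<close>, \<open>d = n\<close>
    the claim.\<close>
  have "f z = g z"
    if "d \<le> n" "z \<in> polydisc n (\<lambda>_. 0) R" "\<forall>r\<in>{Suc d..n}. \<exists>i. z r = q ^ i" for d z
    using that
  proof (induction d arbitrary: z)
    case 0
    then have "\<forall>r. \<exists>i. r \<in> {1..n} \<longrightarrow> z r = q ^ i" by auto
    then obtain N where N: "\<And>r. r \<in> {1..n} \<Longrightarrow> z r = q ^ N r" by metis
    have "z = (\<lambda>r\<in>{1..n}. q ^ N r)"
      using "0.prems"(2) N by (auto simp: polydisc_def PiE_def extensional_def fun_eq_iff)
    then show ?case using eq[of N] by (simp only:)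
  next
    case (Suc d)
    let ?r = "Suc d"
    have r: "?r \<in> {1..n}" using Suc.prems by simp
    define h where "h t = f (z(?r := t)) - g (z(?r := t))" for t
    have hol: "h holomorphic_on ball 0 R"
      unfolding h_def using multi_analytic_on_imp_holomorphic_on[OF f r Suc.prems(2)]
        multi_analytic_on_imp_holomorphic_on[OF g r Suc.prems(2)]
      by (intro holomorphic_intros)
    define U where "U = {q ^ i |i. q ^ i \<in> ball 0 R}"
    have "h (z ?r) = 0"
    proof (rule analytic_continuation[OF hol])
      show "0 islimpt U"
      proof (unfold islimpt_approachable, intro allI impI)
        fix \<epsilon> :: real assume "\<epsilon> > 0"
        then obtain i where "norm q ^ i < min \<epsilon> R"
          using R q real_arch_pow_inv[of "min \<epsilon> R" "norm q"] by auto
        then show "\<exists>x'\<in>U. x' \<noteq> 0 \<and> dist x' 0 < \<epsilon>"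
          using q by (intro bexI[of _ "q ^ i"]) (auto simp: U_def norm_power)
      qed
      fix t assume "t \<in> U"
      then obtain i where t: "t = q ^ i" "t \<in> ball 0 R" by (auto simp: U_def)
      have "f (z(?r := t)) = g (z(?r := t))"
      proof (rule Suc.IH)
        show "z(?r := t) \<in> polydisc n (\<lambda>_. 0) R"
          using Suc.prems(2) t r by (auto simp: polydisc_def PiE_def extensional_def)
        show "\<forall>r\<in>{Suc d..n}. \<exists>i. (z(?r := t)) r = q ^ i"
          using Suc.prems(3) t by auto
      qed (use Suc.prems in simp)
      then show "h t = 0" by (simp add: h_def)
    next
      show "z ?r \<in> ball 0 R"
        using Suc.prems(2) r by (auto simp: polydisc_def PiE_def Pi_def)
    qed (use R in \<open>auto simp: U_def\<close>)
    then show ?case by (simp add: h_def)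
  qed
  from this[of n z] z show ?thesis by auto
qed

section \<open>The identity at the points \<open>q ^ N\<close>\<close>

lemma power_injective:
  fixes q :: complex
  assumes "q \<noteq> 0" "norm q < 1"
  shows "q ^ i = q ^ j \<longleftrightarrow> i = j"
proof
  have "norm q \<noteq> 0" using assms(1) by simp
  moreover assume "q ^ i = q ^ j"
  then have "norm q ^ i = norm q ^ j" by (metis norm_power)
  ultimately show "i = j"
    using assms(2) power_strict_decreasing_iff[of "norm q" i j] power_strict_decreasing_iff[of "norm q" j i]
    by (metis linorder_neqE_nat order_less_irrefl zero_less_norm_iff assms(1))
qed simp

lemma msize_single:
  assumes "1 \<le> n"
  shows "msize n (\<lambda>r\<in>{1..n}. if r = 1 then i else 0) = i"
proof -
  have "msize n (\<lambda>r\<in>{1..n}. if r = 1 then i else 0) = (\<Sum>r=1..n. if r = 1 then i else 0)"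
    unfolding msize_def by (intro sum.cong) auto
  then show ?thesis using assms by simp
qed

text \<open>For \<open>r \<noteq> s\<close> a coincidence \<open>q^i x_r = q^j x_s\<close> would
  annihilate a Vandermonde denominator at a multi-index with the entries \<open>i\<close> and
  \<open>j\<close>; for \<open>r = s\<close> it is excluded by \<open>0 < |q| < 1\<close>.\<close>

lemma no_denominator_vanishes_imp_q_generic:
  assumes n: "1 \<le> n" and q: "q \<noteq> 0" "norm q < 1" and nd: "no_denominator_vanishes n q a b x y"
  shows "q_generic q {1..n} x"
proof
  have x: "x r \<noteq> 0" if "r \<in> {1..n}" for r
    using nd that by (auto simp: no_denominator_vanishes_def)
  have neq: "q ^ i * x r \<noteq> q ^ j * x s" if "r \<in> {1..<s}" "s \<in> {1..n}" for r s i j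
  proof
    assume eq: "q ^ i * x r = q ^ j * x s"
    define J where "J = (\<lambda>t\<in>{1..n}. if t = r then i else if t = s then j else 0)"
    have "J \<in> multi_indices n" by (auto simp: J_def multi_indices_def)
    then have "1 - q powi (int (J r) - int (J s)) * x r / x s \<noteq> 0"
      using nd that unfolding no_denominator_vanishes_def by blast
    moreover have "J r = i" "J s = j" using that by (auto simp: J_def)
    moreover have "q powi (int i - int j) * x r / x s = 1"
      using eq q x[OF that(2)] by (simp add: power_int_diff field_simps)
    ultimately show False by simp
  qed
  show "inj_on (\<lambda>(r, i). q ^ i * x r) ({1..n} \<times> UNIV)"
  proof (rule inj_onI, clarify)
    fix r s i j assume rs: "r \<in> {1..n}" "s \<in> {1..n}" and eq: "q ^ i * x r = q ^ j * x s"
    have "r = s"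
    proof (rule linorder_cases[of r s])
      assume "r < s" then show ?thesis using neq[of r s i j] eq rs by auto
    next
      assume "s < r" then show ?thesis using neq[of s r j i] eq rs by auto
    qed
    then show "r = s \<and> i = j" using eq x[OF rs(1)] power_injective[OF q] by auto
  qed
qed (use n q in auto)

text \<open>These consequences no longer mention \<open>y\<close>, so they apply at every point
  \<open>q^N\<close>. They are read off at multi-indices supported at the first coordinate, which
  exists as \<open>1 <= n\<close>.\<close>

lemma no_denominator_vanishes_imp_powers:
  assumes n: "1 \<le> n" and nd: "no_denominator_vanishes n q a b x y"
  shows "a \<noteq> 1" "a * q ^ Suc i \<noteq> 1" "b * q ^ i \<noteq> 1"
proof -
  let ?k = "\<lambda>i. \<lambda>r\<in>{1..n}. if r = 1 then i else 0::nat"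
  have mem: "?k i \<in> multi_indices n" for i by (auto simp: multi_indices_def)
  show "a \<noteq> 1" using nd by (auto simp: no_denominator_vanishes_def)
  have "qpoch q (a * q) (msize n (?k (Suc i)) + msize n (?k 0)) \<noteq> 0"
    using nd mem unfolding no_denominator_vanishes_def by blast
  then have "qpoch q (a * q) (Suc i) \<noteq> 0" unfolding msize_single[OF n] by simp
  then show "a * q ^ Suc i \<noteq> 1" by (auto simp: qpoch_eq_0_iff mult.assoc)
  \<comment> \<open>The condition offers even lengths only; \<open>2 * Suc i\<close> is large enough
    to contain the factor with index \<open>i\<close>.\<close>
  have "qpoch q b (2 * msize n (?k (Suc i))) \<noteq> 0"
    using nd mem unfolding no_denominator_vanishes_def by blast
  then have "qpoch q b (2 * Suc i) \<noteq> 0" unfolding msize_single[OF n] .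
  then show "b * q ^ i \<noteq> 1" by (auto simp: qpoch_eq_0_iff)
qed

text \<open>There are \<open>s - 1\<close> indices \<open>r < s\<close>, so the weight
  \<open>q^((s-1) k_s)\<close> gives each pair one factor \<open>q^(k_s)\<close>, which clears the
  negative power in its numerator.\<close>

lemma vdm_ratio_eq_vdm_quot:
  assumes "q_generic q {1..n} X"
  shows "vdm_ratio n q X k * q ^ (\<Sum>r=1..n. (r - 1) * k r) = vdm_quot {1..n} X (qshift q k X)"
proof -
  interpret q_generic q "{1..n}" X by fact
  have weight: "q ^ (\<Sum>r=1..n. (r - 1) * k r) = (\<Prod>s=1..n. \<Prod>r=1..<s. q ^ k s)"
    by (simp add: power_sum power_mult mult.commute)
  have "vdm_ratio n q X k * q ^ (\<Sum>r=1..n. (r - 1) * k r)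
      = (\<Prod>s=1..n. \<Prod>r=1..<s. (1 - q powi (int (k r) - int (k s)) * X r / X s) / (1 - X r / X s) * q ^ k s)"
    unfolding weight vdm_ratio_def prod.distrib[symmetric] ..
  also have "\<dots> = (\<Prod>s=1..n. \<Prod>r=1..<s. (qshift q k X s - qshift q k X r) / (X s - X r))"
  proof (intro prod.cong refl)
    fix s r assume s: "s \<in> {1..n}" and r: "r \<in> {1..<s}"
    have nz: "X s \<noteq> 0" "X s - X r \<noteq> 0" "q ^ k s \<noteq> 0"
      using x_nz[OF s] q_nz inj_onD[OF inj_x, of s r] s r by auto
    then have "1 - X r / X s \<noteq> 0" by (simp add: field_simps)
    then show "(1 - q powi (int (k r) - int (k s)) * X r / X s) / (1 - X r / X s) * q ^ k s
        = (qshift q k X s - qshift q k X r) / (X s - X r)"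
      using nz q_nz by (simp add: power_int_diff qshift_def field_simps)
  qed
  also have "\<dots> = vdm_quot {1..n} X (qshift q k X)"
    unfolding vdm_quot_def by (intro prod.cong) auto
  finally show ?thesis .
qed

lemma vdm_ratio_shift:
  assumes "q \<noteq> 0"
  shows "(\<Prod>s=1..n. \<Prod>r=1..<s.
        (1 - q powi (int (m r) - int (m s) + int (j r) - int (j s)) * x r / x s)
        / (1 - q powi (int (j r) - int (j s)) * x r / x s)) = vdm_ratio n q (qshift q j x) m"
  unfolding vdm_ratio_def using assms
  by (intro prod.cong refl) (simp add: qshift_def power_int_diff power_int_add mult_ac)

lemma index_weight:
  fixes q :: complex
  shows "q ^ (\<Sum>r=1..n. r * k r) = q ^ (\<Sum>r=1..n. (r - 1) * k r) * q ^ msize n k"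
proof -
  have "(\<Sum>r=1..n. r * k r) = (\<Sum>r=1..n. (r - 1) * k r + k r)"
    by (intro sum.cong refl) (auto simp: algebra_simps diff_mult_distrib)
  then show ?thesis by (simp add: sum.distrib power_add msize_def)
qed

lemma rhs_m_term_eq:
  assumes "q_generic q {1..n} x"
  defines "X \<equiv> \<lambda>j. qshift q j x"
  shows "rhs_m_term n q a b x K k j m
    = K (\<lambda>r\<in>{1..n}. q ^ (m r + j r))
      * (vdm_quot {1..n} (X j) (qshift q m (X j)) * q ^ msize n m
         * (qpoch_prod q {1..n} (X j) (X k) m / qpoch_prod q {1..n} (\<lambda>r. q * X j r) (X j) m)
         * (qpoch q (a * q ^ (msize n k + msize n j)) (msize n m)
            * qpoch q (b * q ^ (1 + msize n j)) (msize n m)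
            / (qpoch q (a * q) (msize n m + msize n j)
               * qpoch q (b * q ^ (2 * msize n j + 1)) (msize n m))))"
proof -
  interpret q_generic q "{1..n}" x by fact
  have Xj: "qshift q j x = X j" for j by (simp add: X_def)
  have "q_generic q {1..n} (X j)" unfolding X_def by (rule q_generic_qshift)
  note v = vdm_ratio_eq_vdm_quot[OF this, of m, symmetric]
  have "(\<Prod>r=1..n. \<Prod>s=1..n. qpoch q (q powi (- int (k s) + int (j r)) * x r / x s) (m r)
          / qpoch q (q powi (1 + int (j r) - int (j s)) * x r / x s) (m r))
      = (\<Prod>r=1..n. \<Prod>s=1..n. qpoch q (X j r / X k s) (m r) / qpoch q (q * X j r / X j s) (m r))"
    using q_nz by (intro prod.cong refl)
      (simp add: X_def qshift_def power_int_diff power_int_add power_int_minus field_simps)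
  also have "\<dots> = qpoch_prod q {1..n} (X j) (X k) m / qpoch_prod q {1..n} (\<lambda>r. q * X j r) (X j) m"
    by (simp add: qpoch_prod_def prod_dividef)
  finally show ?thesis
    unfolding rhs_m_term_def vdm_ratio_shift[OF q_nz] index_weight Xj v
    by (simp only: mult_ac)
qed

lemma yprod_q_power: "yprod n (\<lambda>r\<in>{1..n}. q ^ N r) = q ^ msize n N"
  by (simp add: yprod_def msize_def power_sum)

lemma y_factor_q_power:
  assumes "q \<noteq> 0"
  shows "y_factor n q x (\<lambda>r\<in>{1..n}. q ^ N r) k
    = qpoch_prod q {1..n} x (qshift q N x) k * q ^ (msize n N * msize n k)"
proof -
  have "y_factor n q x (\<lambda>r\<in>{1..n}. q ^ N r) k = y_factor_generic n q x (\<lambda>r\<in>{1..n}. q ^ N r) k"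
    using assms by (simp add: y_factor_def)
  also have "\<dots> = (\<Prod>r=1..n. \<Prod>s=1..n. qpoch q (x r / qshift q N x s) (k r)) * q ^ (msize n N * msize n k)"
    unfolding y_factor_generic_def yprod_q_power power_mult
    by (intro arg_cong2[where f = "(*)"] prod.cong refl) (simp add: qshift_def mult.commute)
  finally show ?thesis by (simp add: qpoch_prod_def)
qed

text \<open>The split rests on joining \<open>j\<close> and \<open>m\<close> to
  \<open>l = j + m\<close> in the Vandermonde quotients, in the products
  \<open>(q^(-k_s) x_r / x_s)\<close> and in the Pochhammer symbols with \<open>a\<close> and
  \<open>b\<close>.\<close>

lemma rhs_term_q_power:
  assumes gen: "q_generic q {1..n} x" and b: "\<And>i. b * q ^ i \<noteq> 1"
  shows "rhs_term n q a b x K \<beta> (\<lambda>r\<in>{1..n}. q ^ N r) k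
    = (\<Sum>j\<in>(\<Pi>\<^sub>E r\<in>{1..n}. {0..k r}). \<Sum>m\<in>(\<Pi>\<^sub>E r\<in>{1..n}. {0..k r - j r}).
        K (\<lambda>r\<in>{1..n}. q ^ (m r + j r)) * \<beta> j
          * (q_generic.inner_coeff q {1..n} x a b j m
             * q_generic.outer_coeff q {1..n} x a N k (\<lambda>r. j r + m r)))"
proof -
  interpret q_generic q "{1..n}" x by fact
  let ?X = "\<lambda>j. qshift q j x"
  define D where "D = qpoch_prod q {1..n} (\<lambda>r. q * x r) x k"
  define A where "A = 1 - a * q ^ (2 * msize n k)"
  define \<kappa> where "\<kappa> = vdm_quot {1..n} x (?X k)
      * (qpoch_prod q {1..n} x (?X N) k * q ^ (msize n N * msize n k) / D)
      * (A * qpoch q a (msize n k) / ((1 - a) * qpoch q (a * q ^ Suc (msize n N)) (msize n k)))"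
  have \<kappa>: "rhs_term n q a b x K \<beta> (\<lambda>r\<in>{1..n}. q ^ N r) k
      = \<kappa> * (\<Sum>j\<in>(\<Pi>\<^sub>E r\<in>{1..n}. {0..k r}). rhs_j_term n q a b x K \<beta> k j)"
  proof -
    have "D = (\<Prod>r=1..n. \<Prod>s=1..n. qpoch q (q * x r / x s) (k r))"
      by (simp add: D_def qpoch_prod_def)
    moreover have "a * q * yprod n (\<lambda>r\<in>{1..n}. q ^ N r) = a * q ^ Suc (msize n N)"
      unfolding yprod_q_power by simp
    ultimately show ?thesis
      unfolding rhs_term_def \<kappa>_def A_def y_factor_q_power[OF q_nz]
        vdm_ratio_eq_vdm_quot[OF gen, symmetric]
      by (simp only: mult_ac)
  qed
  have "\<kappa> * rhs_j_term n q a b x K \<beta> k j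
      = (\<Sum>m\<in>(\<Pi>\<^sub>E r\<in>{1..n}. {0..k r - j r}). K (\<lambda>r\<in>{1..n}. q ^ (m r + j r)) * \<beta> j
          * (inner_coeff a b j m * outer_coeff a N k (\<lambda>r. j r + m r)))" for j
  proof -
    define pj where "pj = qpoch_prod q {1..n} x (?X k) j"
    \<comment> \<open>The factor with exponent \<open>2|j|\<close> is missing between
      \<open>(b)_(2|j|)\<close> and \<open>(b q^(2|j|+1))_|m|\<close>. Inserting \<open>B\<close>
      above and below gives one symbol of length \<open>2|j| + |m| + 1\<close>.\<close>
    define B where "B = 1 - b * q ^ (2 * msize n j)"
    have B: "B \<noteq> 0" using b by (simp add: B_def)
    have pj: "(\<Prod>r=1..n. \<Prod>s=1..n. qpoch q (q powi (- int (k s)) * x r / x s) (j r)) = pj"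
      unfolding pj_def qpoch_prod_def
      by (intro prod.cong refl) (simp add: qshift_def power_int_minus field_simps)
    have v0: "vdm_ratio n q x j * q ^ (\<Sum>r=1..n. (r - 1) * j r) = vdm_quot {1..n} x (?X j)"
      by (rule vdm_ratio_eq_vdm_quot[OF gen])
    define J where "J = vdm_quot {1..n} x (?X j) * q ^ msize n j * pj
        * (qpoch q (a * q ^ msize n k) (msize n j) * qpoch q (b * q) (msize n j)
           / qpoch q b (2 * msize n j)) * ((- 1) ^ msize n j * q ^ (msize n j choose 2)) * \<beta> j"
    have J: "rhs_j_term n q a b x K \<beta> k j
        = J * (\<Sum>m\<in>(\<Pi>\<^sub>E r\<in>{1..n}. {0..k r - j r}). rhs_m_term n q a b x K k j m)"
      unfolding rhs_j_term_def pj power_add index_weight J_def v0[symmetric] by (simp only: mult_ac)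
    have "\<kappa> * (J * rhs_m_term n q a b x K k j m) = K (\<lambda>r\<in>{1..n}. q ^ (m r + j r)) * \<beta> j
          * (inner_coeff a b j m * outer_coeff a N k (\<lambda>r. j r + m r))" for m
    proof -
      define Km where "Km = K (\<lambda>r\<in>{1..n}. q ^ (m r + j r))"
      define vm where "vm = vdm_quot {1..n} (?X j) (qshift q m (?X j))"
      define P where "P = qpoch_prod q {1..n} (\<lambda>r. q * ?X j r) (?X j) m"
      have v: "vdm_quot {1..n} x (qshift q (\<lambda>r. j r + m r) x) = vdm_quot {1..n} x (?X j) * vm"
        unfolding vm_def vdm_quot_trans[OF fin inj_qshift]
        by (intro vdm_quot_cong) (auto simp: qshift_def power_add mult_ac)
      have qa: "qpoch q a (msize n k + (msize n j + msize n m)) = qpoch q a (msize n k)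
          * qpoch q (a * q ^ msize n k) (msize n j) * qpoch q (a * q ^ (msize n k + msize n j)) (msize n m)"
        by (simp add: qpoch_add power_add mult_ac)
      have qb: "qpoch q (b * q) (msize n j + msize n m)
          = qpoch q (b * q) (msize n j) * qpoch q (b * q ^ (1 + msize n j)) (msize n m)"
        by (simp add: qpoch_add mult_ac)
      have qb': "qpoch q b (Suc (2 * msize n j + msize n m))
          = qpoch q b (2 * msize n j) * B * qpoch q (b * q ^ (2 * msize n j + 1)) (msize n m)"
        using qpoch_add[of q b "Suc (2 * msize n j)" "msize n m"]
        by (simp add: qpoch_Suc B_def)
      have s: "msize n (\<lambda>r. j r + m r) = msize n j + msize n m"
        by (simp add: msize_def sum.distrib)
      have alg: "(v1 * (p * Q / D) * (A * a1 / (a' * a2)) * (v2 * Qj * pj * (a3 * b1 / b2) * S * bj *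
            (k' * (vm * Qm * (pm / P) * (a4 * b3 / (a5 * b4))))))
          = k' * bj * (v2 * vm * (Qj * Qm) * S * (b1 * b3 * B) / (b2 * B * b4 * (a' * a5) * P)
             * (v1 * p / D * Q * (pj * pm) * (A * (a1 * a3 * a4) / a2)))"
        for v1 p Q a1 a' a2 v2 Qj a3 b1 b2 S bj k' Qm pm a4 b3 a5 b4
      proof -
        have "b1 * b3 * B / (b2 * B * b4 * (a' * a5) * P) = b1 * b3 / (b2 * b4 * (a' * a5) * P)"
          using B by simp
        then show ?thesis
          unfolding times_divide_eq_right[symmetric] using B by (simp add: divide_inverse mult_ac)
      qed
      show ?thesis
        unfolding rhs_m_term_eq[OF gen] \<kappa>_def J_def inner_coeff_def outer_coeff_def milne_term_def
          v s msize_def[symmetric] qa qb qb' qpoch_prod_add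
          D_def[symmetric] A_def[symmetric] pj_def[symmetric] vm_def[symmetric] P_def[symmetric] Km_def[symmetric]
          B_def[symmetric] power_add[of q "msize n j" "msize n m"] add.commute[of "msize n m" "msize n j"]
        by (rule alg)
    qed
    then show ?thesis
      unfolding J sum_distrib_left by (intro sum.cong refl)
  qed
  then show ?thesis
    unfolding \<kappa> sum_distrib_left by (intro sum.cong refl)
qed

lemma lhs_term_q_power:
  assumes gen: "q_generic q {1..n} x"
  shows "lhs_term n q b x \<beta> (\<lambda>r\<in>{1..n}. q ^ N r) j
    = \<beta> j * (vdm_quot {1..n} x (qshift q j x)
        * (qpoch_prod q {1..n} x (qshift q N x) j * q ^ (msize n N * msize n j))
        * ((1 - b * q ^ (2 * msize n j)) / ((1 - b) * qpoch q (b * q ^ Suc (msize n N)) (msize n j))))"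
proof -
  interpret q_generic q "{1..n}" x by fact
  have "b * q * yprod n (\<lambda>r\<in>{1..n}. q ^ N r) = b * q ^ Suc (msize n N)"
    unfolding yprod_q_power by simp
  then show ?thesis
    unfolding lhs_term_def y_factor_q_power[OF q_nz] vdm_ratio_eq_vdm_quot[OF gen, symmetric]
    by (simp only: mult_ac)
qed

lemma infsum_box:
  fixes f :: "(nat \<Rightarrow> nat) \<Rightarrow> complex"
  assumes "\<And>k r. k \<in> multi_indices n \<Longrightarrow> r \<in> {1..n} \<Longrightarrow> N r < k r \<Longrightarrow> f k = 0"
  shows "infsum f (multi_indices n) = sum f (\<Pi>\<^sub>E r\<in>{1..n}. {0..N r})"
proof -
  have "infsum f (multi_indices n) = infsum f (\<Pi>\<^sub>E r\<in>{1..n}. {0..N r})"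
  proof (rule infsum_cong_neutral)
    fix k assume k: "k \<in> multi_indices n - (\<Pi>\<^sub>E r\<in>{1..n}. {0..N r})"
    then obtain r where "r \<in> {1..n}" "N r < k r"
      by (auto simp: multi_indices_def PiE_def Pi_def not_le)
    then show "f k = 0" using assms k by blast
  qed (auto simp: multi_indices_def PiE_def)
  also have "\<dots> = sum f (\<Pi>\<^sub>E r\<in>{1..n}. {0..N r})"
    by (intro infsum_finite finite_PiE) auto
  finally show ?thesis .
qed

text \<open>The \<open>y\<close> of the denominator condition is not tied to \<open>N\<close>: in
  the analytic case the condition at one point has to serve for all \<open>N\<close>.\<close>

lemma lhs_eq_rhs_q_power:
  assumes n: "1 \<le> n" and q: "q \<noteq> 0" "norm q < 1" and nd: "no_denominator_vanishes n q a b x y"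
  shows "lhs n q b x K \<beta> (\<lambda>r\<in>{1..n}. q ^ N r) = rhs n q a b x K \<beta> (\<lambda>r\<in>{1..n}. q ^ N r)"
proof -
  note gen = no_denominator_vanishes_imp_q_generic[OF n q nd]
  note ab = no_denominator_vanishes_imp_powers[OF n nd]
  interpret q_generic q "{1..n}" x by (rule gen)
  \<comment> \<open>The evaluation of the coefficients needs an extensional \<open>N\<close>, while
    the given one has arbitrary values outside \<open>{1..n}\<close>.\<close>
  define M where "M = restrict N {1..n}"
  define y' where "y' = (\<lambda>r\<in>{1..n}. q ^ M r)"
  have y': "y' = (\<lambda>r\<in>{1..n}. q ^ N r)" by (auto simp: y'_def M_def fun_eq_iff)
  have M: "M \<in> extensional {1..n}" by (simp add: M_def)
  have y_factor_0: "y_factor n q x y' k = 0" if "r \<in> {1..n}" "M r < k r" for k r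
    unfolding y'_def y_factor_q_power[OF q_nz] using qpoch_prod_eq_0[of r M k] that by simp
  have "rhs n q a b x K \<beta> y' = (\<Sum>k\<in>(\<Pi>\<^sub>E r\<in>{1..n}. {0..M r}). rhs_term n q a b x K \<beta> y' k)"
    unfolding rhs_def by (intro infsum_box) (simp add: rhs_term_def y_factor_0)
  also have "\<dots> = (\<Sum>k\<in>(\<Pi>\<^sub>E r\<in>{1..n}. {0..M r}). \<Sum>j\<in>(\<Pi>\<^sub>E r\<in>{1..n}. {0..k r}).
      \<Sum>m\<in>(\<Pi>\<^sub>E r\<in>{1..n}. {0..k r - j r}).
        K (\<lambda>r\<in>{1..n}. q ^ ((\<lambda>r\<in>{1..n}. m r + j r) r)) * \<beta> j
          * (inner_coeff a b j m * outer_coeff a M k (\<lambda>r. j r + m r)))"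
    unfolding y'_def rhs_term_q_power[OF gen ab(3)]
    by (intro sum.cong refl arg_cong2[where f = "(*)"] arg_cong[where f = K]) auto
  also have "\<dots> = (\<Sum>j\<in>(\<Pi>\<^sub>E r\<in>{1..n}. {0..M r}). K y' * lhs_term n q b x \<beta> y' j)"
    unfolding triangular_sum[OF ab M, where \<kappa> = "\<lambda>l. K (\<lambda>r\<in>{1..n}. q ^ l r)"]
    unfolding y'_def lhs_term_q_power[OF gen] msize_def[symmetric] by (simp only: mult.assoc)
  also have "\<dots> = lhs n q b x K \<beta> y'"
    unfolding lhs_def sum_distrib_left[symmetric]
    by (subst infsum_box[where N = M]) (simp_all add: lhs_term_def y_factor_0)
  finally show ?thesis unfolding y' ..
qed

theorem theorem1p2:
  fixes n :: nat and q a b :: complex and x y :: "nat \<Rightarrow> complex"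
    and K :: "(nat \<Rightarrow> complex) \<Rightarrow> complex" and \<beta> :: "(nat \<Rightarrow> nat) \<Rightarrow> complex"
  assumes n: "n \<ge> 1"
    and q: "0 < norm q" "norm q < 1"
    and y: "y \<in> {1..n} \<rightarrow>\<^sub>E UNIV"
    and denominators: "no_denominator_vanishes n q a b x y"
    and cases:
      "(\<exists>R>0.
          (\<forall>z\<in>polydisc n (\<lambda>_. 0) R.
             (\<lambda>j. norm (lhs_term n q b x \<beta> z j)) summable_on multi_indices n \<and>
             (\<lambda>k. norm (rhs_term n q a b x K \<beta> z k)) summable_on multi_indices n) \<and>
          multi_analytic_on n (lhs n q b x K \<beta>) (polydisc n (\<lambda>_. 0) R) \<and>
          multi_analytic_on n (rhs n q a b x K \<beta>) (polydisc n (\<lambda>_. 0) R) \<and>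
          y \<in> polydisc n (\<lambda>_. 0) R)
       \<or> (\<exists>N :: nat \<Rightarrow> nat. \<forall>r\<in>{1..n}. y r = q ^ N r)"
  shows "lhs n q b x K \<beta> y = rhs n q a b x K \<beta> y"
proof -
  have q': "q \<noteq> 0" using q by auto
  note eq = lhs_eq_rhs_q_power[OF n q' q(2) denominators, of K \<beta>]
  from cases show ?thesis
  proof
    assume "\<exists>R>0. (\<forall>z\<in>polydisc n (\<lambda>_. 0) R.
             (\<lambda>j. norm (lhs_term n q b x \<beta> z j)) summable_on multi_indices n \<and>
             (\<lambda>k. norm (rhs_term n q a b x K \<beta> z k)) summable_on multi_indices n) \<and>
          multi_analytic_on n (lhs n q b x K \<beta>) (polydisc n (\<lambda>_. 0) R) \<and>
          multi_analytic_on n (rhs n q a b x K \<beta>) (polydisc n (\<lambda>_. 0) R) \<and>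
          y \<in> polydisc n (\<lambda>_. 0) R"
    then obtain R where "R > 0" "y \<in> polydisc n (\<lambda>_. 0) R"
      "multi_analytic_on n (lhs n q b x K \<beta>) (polydisc n (\<lambda>_. 0) R)"
      "multi_analytic_on n (rhs n q a b x K \<beta>) (polydisc n (\<lambda>_. 0) R)"
      by blast
    then show ?thesis
      using multi_analytic_identity[where f = "lhs n q b x K \<beta>" and g = "rhs n q a b x K \<beta>",
          OF _ _ _ q' q(2) eq] by blast
  next
    assume "\<exists>N :: nat \<Rightarrow> nat. \<forall>r\<in>{1..n}. y r = q ^ N r"
    then obtain N where "\<forall>r\<in>{1..n}. y r = q ^ N r" by blast
    then have "y = (\<lambda>r\<in>{1..n}. q ^ N r)"
      using y by (auto simp: fun_eq_iff PiE_def extensional_def)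
    then show ?thesis using eq[of N] by (simp only:)
  qed
qed

end
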